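(* Let $k,m\ge2$ be integers and $n\in\mathbb N=\{1,2,\dots\}$. Let $\mathsf d$ be the normalized shortest path metric on $V(\mathsf D_{k,m}^{\oslash n})$, i.e. the shortest path metric in which every edge has length $k^{-n}$; let $\mu$ be the degree-probability measure on $V(\mathsf D_{k,m}^{\oslash n})$, and $\nu$ the uniform probability measure on $E(\mathsf D_{k,m}^{\oslash n})$. Then $\mathsf D_{k,m}^{\oslash n}$ has $(\mu,\nu,\mathsf d)$-isoperimetric dimension $1+\frac{\log m}{\log k}$ with some constant $C_{iso}\le\frac m2$, and $(\mu,\mathsf d)$-Lipschitz-spectral profile of dimension $1+\frac{\log m}{\log k}$ and bandwidth $k^n$ with some constants $C_1\le6$, $C_\infty\le1$, $C_\gamma\le2k^2m^2$.
   Context: **Graphs.** Graphs are finite, connected, directed, with at least one edge, without self-loops or multiple edges between the same pair of vertices. For $e=(u,v)\in E(G)$, $e^-=u$, $e^+=v$. Path metrics ignore orientations. Write $\mathsf d(e)=\mathsf d(e^-,e^+)$. The degree-probability measure on $V(G)$ is $\mu(x)=\deg(x)/(2|E(G)|)$. **$s$-$t$ graphs.** An $s$-$t$ graph is a graph $G$ with two distinct distinguished vertices $s(G)$ (source), $t(G)$ (sink) such that every vertex lies on a directed path from $s(G)$ to $t(G)$. **Diamond graphs.** For integers $k,m\ge2$, let $\mathsf P_k$ be the path with vertices $\{i/k:0\le i\le k\}$ and edges $(\frac{i-1}{k},\frac ik)$, $1\le i\le k$. $\mathsf D_{k,m}$ is the $s$-$t$ graph with vertex set $V(\mathsf P_k)\times\{1,\dots,m\}/\sim$,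 where all $(0,i)$ are identified (the source) and all $(1,i)$ are identified (the sink), and with edges $([(e^-,i)],[(e^+,i)])$, $e\in E(\mathsf P_k)$, $1\le i\le m$. **$\oslash$-products.** For a graph $H$ and an $s$-$t$ graph $G$, $H\oslash G$ is obtained by replacing each edge $e$ of $H$ by a copy of $G$, with $s(G)$ placed at $e^-$ and $t(G)$ at $e^+$. Precisely, $V(H\oslash G)=E(H)\times V(G)/\sim$, where $(e_1,u_1)\sim(e_2,u_2)$ iff they are equal, or $u_1,u_2\in\{s(G),t(G)\}$ and the corresponding endpoints in $H$ coincide ($(e,s(G))$ corresponds to $e^-$, $(e,t(G))$ to $e^+$). The class of $(e,u)$ is $e\oslash u$, and the edges are $e\oslash f:=(e\oslash f^-,e\oslash f^+)$. If $H$ is an $s$-$t$ graph, so is $H\oslash G$ with $s(H\oslash G)=s(H)$, $t(H\oslash G)=t(H)$ (viewing $V(H)\subset V(H\oslash G)$). Powers: $G^{\oslash1}=G$, $G^{\oslash (n+1)}=G^{\oslash n}\oslash G$. **Isoperimetric dimension.** $G$ has $(\mu,\nu,\mathsf d)$-isoperimetric dimension $\delta$ with constant $C_{iso}$ if for every $A\subset V(G)$, $\min\{\mu(A),\mu(A^c)\}^{\frac{\delta-1}{\delta}}\le C_{iso}\,\mathrm{Per}_{\nu,\mathsf d}(A)$, where $\partial_GA=\{(x,y)\in E(G):|\{x,y\}\cap A|=1\}$ and $\mathrm{Per}_{\nu,\mathsf d}(A)=\sum_{e\in\partial_GA}\frac{\nu(e)}{\mathsf d(e)}$. **Lipschitz-spectral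 profile.** For a family $F=\{f_i\}_{i\in I}$ of Lipschitz functions, $\gamma_F(s)=|\{i\in I:\mathrm{Lip}(f_i)\le s\}|$. For $\delta,\beta\in[1,\infty)$, $G$ has $(\mu,\mathsf d)$-Lipschitz-spectral profile of dimension $\delta$ and bandwidth $\beta$ with constants $C_1,C_\infty,C_\gamma\in(0,\infty)$ if there is a collection $F=\{f_i:V(G)\to\mathbb R\}_{i\in I}$ such that (1) $C_1^{-1}\le\inf_i\|f_i\|_{L_1(\mu)}\le\sup_i\|f_i\|_{L_\infty(\mu)}\le C_\infty$; (2) $\{f_i\}$ is orthogonal in $L_2(\mu)$; (3) for every $s\in[1,\beta]$, $\gamma_F(s)\ge C_\gamma^{-1}s^\delta$. *)

theory Defs
  imports
    Complex_Main
    "HOL-Library.FSet"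
    "Graph_Theory.Pair_Digraph"
    "Graph_Theory.Digraph_Component"
    "Graph_Theory.Shortest_Path"
begin

section \<open>Graphs with a source and a sink\<close>

record 'a st_graph =
  digraph_of :: "'a pair_pre_digraph"
  source :: 'a
  sink :: 'a

abbreviation st_verts :: "'a st_graph \<Rightarrow> 'a set" where
  "st_verts G \<equiv> pverts (digraph_of G)"

abbreviation st_arcs :: "'a st_graph \<Rightarrow> ('a \<times> 'a) set" where
  "st_arcs G \<equiv> parcs (digraph_of G)"

definition relabel :: "('a \<Rightarrow> 'b) \<Rightarrow> 'a st_graph \<Rightarrow> 'b st_graph" where
  "relabel h G =
    \<lparr> digraph_of = \<lparr> pverts = h ` st_verts G, parcs = map_prod h h ` st_arcs G \<rparr>,
      source = h (source G), sink = h (sink G) \<rparr>"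

section \<open>Diamond graphs\<close>

definition path_graph :: "nat \<Rightarrow> real pair_pre_digraph" where
  "path_graph k =
    \<lparr> pverts = {real i / real k | i. i \<le> k},
      parcs = {(real (i - 1) / real k, real i / real k) | i. 1 \<le> i \<and> i \<le> k} \<rparr>"

definition diamond_rel :: "nat \<Rightarrow> nat \<Rightarrow> (real \<times> nat) rel" where
  "diamond_rel k m =
    {((x, i), (y, j)). (x, i) \<in> pverts (path_graph k) \<times> {1..m}
      \<and> (y, j) \<in> pverts (path_graph k) \<times> {1..m}
      \<and> x = y \<and> (i = j \<or> x = 0 \<or> x = 1)}"

definition diamond_class :: "nat \<Rightarrow> nat \<Rightarrow> real \<Rightarrow> nat \<Rightarrow> (real \<times> nat) set" where
  "diamond_class k m x i = diamond_rel k m `` {(x, i)}"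

definition diamond :: "nat \<Rightarrow> nat \<Rightarrow> (real \<times> nat) set st_graph" where
  "diamond k m =
    \<lparr> digraph_of =
        \<lparr> pverts = (pverts (path_graph k) \<times> {1..m}) // diamond_rel k m,
          parcs = {(diamond_class k m (fst e) i, diamond_class k m (snd e) i) | e i.
                    e \<in> parcs (path_graph k) \<and> i \<in> {1..m}} \<rparr>,
      source = diamond_class k m 0 1, sink = diamond_class k m 1 1 \<rparr>"

section \<open>Slash products and powers\<close>

text \<open>The vertex of \<^term>\<open>H\<close> at which \<^term>\<open>(e, u)\<close> is placed, for \<^term>\<open>u\<close> the source or the
  sink of \<^term>\<open>G\<close>.\<close>

definition slash_endpoint :: "'b st_graph \<Rightarrow> ('a \<times> 'a) \<times> 'b \<Rightarrow> 'a" where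
  "slash_endpoint G p = (if snd p = source G then fst (fst p) else snd (fst p))"

definition slash_rel :: "'a st_graph \<Rightarrow> 'b st_graph \<Rightarrow> (('a \<times> 'a) \<times> 'b) rel" where
  "slash_rel H G =
    {(p, q). p \<in> st_arcs H \<times> st_verts G \<and> q \<in> st_arcs H \<times> st_verts G
      \<and> (p = q \<or> snd p \<in> {source G, sink G} \<and> snd q \<in> {source G, sink G}
            \<and> slash_endpoint G p = slash_endpoint G q)}"

definition slash_class ::
    "'a st_graph \<Rightarrow> 'b st_graph \<Rightarrow> 'a \<times> 'a \<Rightarrow> 'b \<Rightarrow> (('a \<times> 'a) \<times> 'b) set" where
  "slash_class H G e u = slash_rel H G `` {(e, u)}"

text \<open>A vertex of \<^term>\<open>H\<close>, viewed as a vertex of the product: the class of all pairs placed at it.\<close>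

definition slash_embed :: "'a st_graph \<Rightarrow> 'b st_graph \<Rightarrow> 'a \<Rightarrow> (('a \<times> 'a) \<times> 'b) set" where
  "slash_embed H G v = {p \<in> st_arcs H \<times> {source G, sink G}. slash_endpoint G p = v}"

definition slash :: "'a st_graph \<Rightarrow> 'b st_graph \<Rightarrow> (('a \<times> 'a) \<times> 'b) set st_graph" where
  "slash H G =
    \<lparr> digraph_of =
        \<lparr> pverts = (st_arcs H \<times> st_verts G) // slash_rel H G,
          parcs = {(slash_class H G e (fst f), slash_class H G e (snd f)) | e f.
                    e \<in> st_arcs H \<and> f \<in> st_arcs G} \<rparr>,
      source = slash_embed H G (source H), sink = slash_embed H G (sink H) \<rparr>"

text \<open>The vertex type of \<^term>\<open>slash H G\<close> differs from that of \<^term>\<open>H\<close>. To iterate the product,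
  the vertices of all powers of \<^term>\<open>G\<close> live in one recursive type: a vertex is either a vertex of
  \<^term>\<open>G\<close> or a (finite) equivalence class of pairs of an edge of the previous power and a vertex
  of \<^term>\<open>G\<close>. For finite graphs \<^term>\<open>\<lambda>X. Class (Abs_fset X)\<close> is injective on the classes, so each
  relabelling below is an isomorphism of s-t graphs.\<close>

datatype 'b power_vertex =
    Base 'b
  | Class "(('b power_vertex \<times> 'b power_vertex) \<times> 'b) fset"

text \<open>Only the powers with positive exponent are specified.\<close>

fun slash_power :: "'b st_graph \<Rightarrow> nat \<Rightarrow> 'b power_vertex st_graph" where
  "slash_power G (Suc 0) = relabel Base G"
| "slash_power G (Suc (Suc n)) =
    relabel (\<lambda>X. Class (Abs_fset X)) (slash (slash_power G (Suc n)) G)"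

section \<open>Metric and measures on a graph\<close>

text \<open>The shortest path metric for which every edge has length \<^term>\<open>l\<close>, ignoring orientations.\<close>

definition path_metric :: "'a pair_pre_digraph \<Rightarrow> real \<Rightarrow> 'a \<Rightarrow> 'a \<Rightarrow> real" where
  "path_metric G l x y =
    real_of_ereal (wf_digraph.\<mu> (with_proj (mk_symmetric (with_proj G))) (\<lambda>_. l) x y)"

definition degree_prob :: "'a pair_pre_digraph \<Rightarrow> 'a \<Rightarrow> real" where
  "degree_prob G x =
    real (in_degree (with_proj G) x + out_degree (with_proj G) x) / (2 * real (card (parcs G)))"

definition uniform_prob :: "'a pair_pre_digraph \<Rightarrow> 'a \<times> 'a \<Rightarrow> real" where
  "uniform_prob G e = 1 / real (card (parcs G))"

section \<open>Isoperimetric dimension\<close>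

definition edge_boundary :: "'a pair_pre_digraph \<Rightarrow> 'a set \<Rightarrow> ('a \<times> 'a) set" where
  "edge_boundary G A = {e \<in> parcs G. card ({fst e, snd e} \<inter> A) = 1}"

definition perimeter ::
    "'a pair_pre_digraph \<Rightarrow> ('a \<times> 'a \<Rightarrow> real) \<Rightarrow> ('a \<Rightarrow> 'a \<Rightarrow> real) \<Rightarrow> 'a set \<Rightarrow> real" where
  "perimeter G \<nu> d A = (\<Sum>e\<in>edge_boundary G A. \<nu> e / d (fst e) (snd e))"

definition isoperimetric_dimension ::
    "'a pair_pre_digraph \<Rightarrow> ('a \<Rightarrow> real) \<Rightarrow> ('a \<times> 'a \<Rightarrow> real) \<Rightarrow> ('a \<Rightarrow> 'a \<Rightarrow> real)
      \<Rightarrow> real \<Rightarrow> real \<Rightarrow> bool" where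
  "isoperimetric_dimension G \<mu> \<nu> d \<delta> C_iso \<longleftrightarrow>
    (\<forall>A \<subseteq> pverts G.
      min (\<Sum>x\<in>A. \<mu> x) (\<Sum>x\<in>pverts G - A. \<mu> x) powr ((\<delta> - 1) / \<delta>)
        \<le> C_iso * perimeter G \<nu> d A)"

section \<open>Lipschitz-spectral profile\<close>

definition Lip :: "'a set \<Rightarrow> ('a \<Rightarrow> 'a \<Rightarrow> real) \<Rightarrow> ('a \<Rightarrow> real) \<Rightarrow> real" where
  "Lip X d f = (SUP p\<in>{(x, y). x \<in> X \<and> y \<in> X \<and> x \<noteq> y}.
     \<bar>f (fst p) - f (snd p)\<bar> / d (fst p) (snd p))"

definition L1_norm :: "'a set \<Rightarrow> ('a \<Rightarrow> real) \<Rightarrow> ('a \<Rightarrow> real) \<Rightarrow> real" where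
  "L1_norm X \<mu> f = (\<Sum>x\<in>X. \<bar>f x\<bar> * \<mu> x)"

definition L2_inner :: "'a set \<Rightarrow> ('a \<Rightarrow> real) \<Rightarrow> ('a \<Rightarrow> real) \<Rightarrow> ('a \<Rightarrow> real) \<Rightarrow> real" where
  "L2_inner X \<mu> f g = (\<Sum>x\<in>X. f x * g x * \<mu> x)"

text \<open>On a finite set the essential supremum is the maximum over the points of positive mass.\<close>

definition Linf_norm :: "'a set \<Rightarrow> ('a \<Rightarrow> real) \<Rightarrow> ('a \<Rightarrow> real) \<Rightarrow> real" where
  "Linf_norm X \<mu> f = Max {\<bar>f x\<bar> | x. x \<in> X \<and> \<mu> x > 0}"

definition profile_count ::
    "'a set \<Rightarrow> ('a \<Rightarrow> 'a \<Rightarrow> real) \<Rightarrow> 'i set \<Rightarrow> ('i \<Rightarrow> 'a \<Rightarrow> real) \<Rightarrow> real \<Rightarrow> nat" where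
  "profile_count X d I f s = card {i \<in> I. Lip X d (f i) \<le> s}"

text \<open>On a finite graph an orthogonal family of functions with \<^term>\<open>L1_norm\<close> bounded below by a
  positive constant is finite, so index sets of natural numbers are general enough.\<close>

definition lipschitz_spectral_profile ::
    "'a pair_pre_digraph \<Rightarrow> ('a \<Rightarrow> real) \<Rightarrow> ('a \<Rightarrow> 'a \<Rightarrow> real) \<Rightarrow> real \<Rightarrow> real
      \<Rightarrow> real \<Rightarrow> real \<Rightarrow> real \<Rightarrow> bool" where
  "lipschitz_spectral_profile G \<mu> d \<delta> \<beta> C_1 C_inf C_gam \<longleftrightarrow>
    1 \<le> \<delta> \<and> 1 \<le> \<beta> \<and> 0 < C_1 \<and> 0 < C_inf \<and> 0 < C_gam \<and>
    (\<exists>(I :: nat set) (f :: nat \<Rightarrow> 'a \<Rightarrow> real).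
      (\<forall>i\<in>I. inverse C_1 \<le> L1_norm (pverts G) \<mu> (f i) \<and> Linf_norm (pverts G) \<mu> (f i) \<le> C_inf) \<and>
      (\<forall>i\<in>I. \<forall>j\<in>I. i \<noteq> j \<longrightarrow> L2_inner (pverts G) \<mu> (f i) (f j) = 0) \<and>
      (\<forall>s\<in>{1..\<beta>}. inverse C_gam * s powr \<delta> \<le> real (profile_count (pverts G) d I f s)))"

end

theory Submission
  imports Defs
begin

text \<open>Isoperimetry. The exponent \<open>\<alpha>\<close> satisfies \<open>(k m)\<^sup>\<alpha> = m\<close>, so the inequality is invariant under
  passing to the \<open>k m\<close> copies of the previous power. A set separating the source from the sink
  cuts at least \<open>m\<^sup>n\<close> edges. If a set contains neither of them but an interior vertex of the
  outermost diamond, then two of the copies are separated, and that many cut edges suffice for any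
  mass; otherwise no copy has an end in the set, and the inequalities for the copies add
  up by the subadditivity of \<open>x \<mapsto> x\<^sup>\<alpha>\<close>.

  Lipschitz-spectral profile. At level \<open>j\<close>, on each of the \<open>K = (k m)\<^sup>j\<close> diamonds that
  replace the edges of level \<open>j\<close>, pair up the branches and put \<open>1\<close> on the interior vertices of one
  branch and \<open>-1\<close> on those of the other; combine these bumps over all diamonds with signs from an
  orthogonal family of more than \<open>K / 2\<close> vectors (a Hadamard matrix whose order is a power of two,
  extended by zeros) and extend affinely to the finer levels. The Lipschitz constant is at most
  \<open>k\<^bsup>j + 1\<^esup>\<close>. Different levels are orthogonal because a function that is affine on a diamond takes
  the same values on paired branches. The factors \<open>1 / 2\<close> (order of the Hadamard matrix),
  \<open>2 / 3\<close> (an unpaired branch if \<open>m\<close> is odd) and \<open>1 / 2\<close> (slopes at the ends of the branches) give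
  the bound \<open>1 / 6\<close> for the \<open>L\<^sub>1\<close> norms.\<close>

section \<open>Auxiliary facts on sums and signs\<close>

lemma neq_step:
  fixes f :: "nat \<Rightarrow> 'c"
  assumes "f a \<noteq> f c" "a \<le> c"
  obtains i where "a \<le> i" "i < c" "f i \<noteq> f (Suc i)"
  using assms(2,1)
proof (induction arbitrary: thesis rule: dec_induct)
  case (step c)
  show ?case
  proof (cases "f a = f c")
    case True
    then show ?thesis using step.prems step.hyps by auto
  next
    case False
    then show ?thesis using step.IH step.prems(1) by (metis less_SucI)
  qed
qed simp

text \<open>Each share \<open>x i / ?S\<close> of the total lies in \<open>[0, 1]\<close>, where a
  power with exponent \<open>a \<le> 1\<close> does not decrease it; the shares add up to 1.\<close>

lemma powr_sum_le:
  fixes x :: "'i \<Rightarrow> real"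
  assumes "finite I" "\<And>i. i \<in> I \<Longrightarrow> 0 \<le> x i" "0 < a" "a \<le> 1"
  shows "(\<Sum>i\<in>I. x i) powr a \<le> (\<Sum>i\<in>I. x i powr a)"
proof (cases "(\<Sum>i\<in>I. x i) = 0")
  case True
  then show ?thesis by (simp add: sum_nonneg)
next
  case False
  let ?S = "\<Sum>i\<in>I. x i"
  have S: "0 < ?S" using False sum_nonneg[of I x] assms(2) by fastforce
  have "x i / ?S * ?S powr a \<le> x i powr a" if "i \<in> I" for i
  proof (cases "x i = 0")
    case False
    then have xi: "0 < x i" using assms(2)[OF that] by simp
    have le: "x i \<le> ?S" using that assms by (intro member_le_sum) auto
    have "x i / ?S \<le> (x i / ?S) powr a"
      using powr_mono'[of a 1 "x i / ?S"] xi le S assms(3,4) by simp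
    then show ?thesis
      using S xi by (simp add: powr_divide field_simps)
  qed simp
  then have "(\<Sum>i\<in>I. x i / ?S * ?S powr a) \<le> (\<Sum>i\<in>I. x i powr a)"
    by (rule sum_mono)
  moreover have "(\<Sum>i\<in>I. x i / ?S * ?S powr a) = ?S powr a"
    using S by (simp add: sum_distrib_right[symmetric] sum_divide_distrib[symmetric])
  ultimately show ?thesis by simp
qed

lemma sum_lessThan_add:
  fixes F :: "nat \<Rightarrow> 'a::comm_monoid_add"
  shows "(\<Sum>x<a + b. F x) = (\<Sum>x<a. F x) + (\<Sum>x<b. F (a + x))"
  by (induction b) (simp_all add: add.assoc)

text \<open>Sylvester's doubling construction.\<close>

lemma ex_hadamard:
  "\<exists>H :: nat \<Rightarrow> nat \<Rightarrow> real. (\<forall>i x. \<bar>H i x\<bar> = 1) \<and>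
     (\<forall>i<2 ^ a. \<forall>j<2 ^ a. i \<noteq> j \<longrightarrow> (\<Sum>x<2 ^ a. H i x * H j x) = 0)"
proof (induction a)
  case 0
  show ?case by (rule exI[of _ "\<lambda>_ _. 1"]) simp
next
  case (Suc a)
  define M :: nat where "M = 2 ^ a"
  have M: "2 ^ Suc a = M + M" "0 < M" by (simp_all add: M_def)
  obtain H :: "nat \<Rightarrow> nat \<Rightarrow> real" where H: "\<And>i x. \<bar>H i x\<bar> = 1"
    "\<And>i j. i < M \<Longrightarrow> j < M \<Longrightarrow> i \<noteq> j \<Longrightarrow> (\<Sum>x<M. H i x * H j x) = 0"
    using Suc unfolding M_def by blast
  \<comment> \<open>The block matrix with rows \<open>(H, H)\<close> and \<open>(H, -H)\<close>;
    \<open>sg\<close> is the sign of its right half.\<close>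
  define sg :: "nat \<Rightarrow> real" where "sg i = (if M \<le> i then -1 else 1)" for i
  define H' where "H' i x = H (i mod M) (x mod M) * (if M \<le> x then sg i else 1)" for i x
  have "\<bar>H' i x\<bar> = 1" for i x
    by (simp add: H'_def sg_def abs_mult H)
  moreover have "(\<Sum>x<M + M. H' i x * H' j x) = 0" if ij: "i < M + M" "j < M + M" "i \<noteq> j" for i j
  proof -
    let ?S = "\<Sum>x<M. H (i mod M) x * H (j mod M) x"
    have "(\<Sum>x<M + M. H' i x * H' j x) = ?S + (\<Sum>x<M. sg i * sg j * (H (i mod M) x * H (j mod M) x))"
      unfolding sum_lessThan_add by (intro arg_cong2[of _ _ _ _ "(+)"] sum.cong) (auto simp: H'_def)
    also have "\<dots> = (1 + sg i * sg j) * ?S"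
      by (simp add: sum_distrib_left[symmetric] algebra_simps)
    \<comment> \<open>Distinct rows within one block row come from distinct rows of
      \<open>H\<close>; in different block rows the factor \<open>1 + sg i * sg j\<close>
      vanishes.\<close>
    also have "\<dots> = 0"
    proof (cases "sg i = sg j")
      case True
      then have "(M \<le> i) = (M \<le> j)" by (simp add: sg_def split: if_splits)
      then have "i mod M \<noteq> j mod M"
        using ij by (auto simp: le_mod_geq mod_if split: if_splits)
      then show ?thesis using H(2)[of "i mod M" "j mod M"] M by simp
    next
      case False
      then show ?thesis by (auto simp: sg_def split: if_splits)
    qed
    finally show ?thesis .
  qed
  ultimately show ?case
    unfolding M(1) by blast
qed

text \<open>For a Lipschitz scale \<open>s\<close> this picks the level to be counted, at the cost
  of one factor \<open>k\<close>.\<close>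

lemma ex_power_bounds:
  fixes k s :: real
  assumes "1 \<le> k" "1 \<le> s" "s \<le> k ^ N"
  shows "\<exists>n\<le>N. k ^ n \<le> s \<and> s \<le> k ^ Suc n"
  using assms
proof (induction N)
  case (Suc N)
  show ?case
  proof (cases "s \<le> k ^ N")
    case True
    then show ?thesis using Suc le_SucI by blast
  next
    case False
    then show ?thesis using Suc.prems by (intro exI[of _ N]) auto
  qed
qed auto

text \<open>With \<open>M\<close> the largest power of two up to \<open>card S\<close>, the rows of
  a Hadamard matrix of order \<open>M\<close> are placed on \<open>M\<close> points of
  \<open>S\<close> and extended by zero; maximality gives \<open>card S < 2 * M\<close>.\<close>

lemma ex_orthogonal_signs:
  assumes "finite S" "S \<noteq> {}"
  shows "\<exists>M (v :: nat \<Rightarrow> 'a \<Rightarrow> real). card S < 2 * M \<and>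
    (\<forall>i<M. (\<forall>x. \<bar>v i x\<bar> \<le> 1) \<and> (\<Sum>x\<in>S. \<bar>v i x\<bar>) = real M) \<and>
    (\<forall>i<M. \<forall>j<M. i \<noteq> j \<longrightarrow> (\<Sum>x\<in>S. v i x * v j x) = 0)"
proof -
  let ?N = "card S"
  have N: "1 \<le> ?N" using assms by (simp add: Suc_leI card_gt_0_iff)
  obtain a where a: "2 ^ a \<le> ?N" "?N < 2 ^ (a + 1)"
    using ex_power_ivl1[of 2 ?N] N by auto
  obtain H :: "nat \<Rightarrow> nat \<Rightarrow> real" where H: "\<And>i x. \<bar>H i x\<bar> = 1"
    "\<And>i j. i < 2 ^ a \<Longrightarrow> j < 2 ^ a \<Longrightarrow> i \<noteq> j \<Longrightarrow> (\<Sum>x<2 ^ a. H i x * H j x) = 0"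
    using ex_hadamard[of a] by blast
  obtain h where h: "bij_betw h S {0..<?N}"
    using ex_bij_betw_finite_nat[OF assms(1)] by auto
  define v where "v i x = (if h x < 2 ^ a then H i (h x) else 0)" for i x
  have *: "(\<Sum>x\<in>S. if h x < 2 ^ a then F (h x) else 0) = (\<Sum>y<2 ^ a. F y)" for F :: "nat \<Rightarrow> real"
  proof -
    have "(\<Sum>x\<in>S. if h x < 2 ^ a then F (h x) else 0) = (\<Sum>y\<in>{0..<?N}. if y < 2 ^ a then F y else 0)"
      by (rule sum.reindex_bij_betw[OF h])
    also have "\<dots> = (\<Sum>y<2 ^ a. F y)"
      using a(1) by (intro sum.mono_neutral_cong_right) auto
    finally show ?thesis .
  qed
  have "(\<Sum>x\<in>S. \<bar>v i x\<bar>) = 2 ^ a" for i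
    using *[of "\<lambda>y. \<bar>H i y\<bar>"] by (simp add: v_def if_distrib[of abs] H(1) cong: if_cong)
  moreover have "(\<Sum>x\<in>S. v i x * v j x) = (\<Sum>y<2 ^ a. H i y * H j y)" for i j
    unfolding *[symmetric] by (rule sum.cong) (auto simp: v_def)
  ultimately show ?thesis
    using a(2) H by (intro exI[of _ "2 ^ a"] exI[of _ v]) (auto simp: v_def)
qed

section \<open>Iterated replacement of edges by diamonds\<close>

text \<open>\<open>E n\<close> is the edge set of level \<open>n\<close>, \<open>\<phi> n\<close> embeds the vertices of level
  \<open>n\<close> into those of level \<open>Suc n\<close>, and \<open>p n e i b\<close> is the vertex at position
  \<open>i\<close> on branch \<open>b\<close> of the diamond replacing the edge \<open>e\<close>.\<close>

locale diamond_refinement =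
  fixes k m :: nat
    and E :: "nat \<Rightarrow> ('v \<times> 'v) set"
    and \<phi> :: "nat \<Rightarrow> 'v \<Rightarrow> 'v"
    and p :: "nat \<Rightarrow> 'v \<times> 'v \<Rightarrow> nat \<Rightarrow> nat \<Rightarrow> 'v"
    and s t :: 'v
  assumes k2: "2 \<le> k" and m2: "2 \<le> m"
    and E_0: "E 0 = {(s, t)}" and s_neq_t: "s \<noteq> t"
    and E_Suc: "E (Suc n) = (\<lambda>(e, i, b). (p n e i b, p n e (Suc i) b)) ` (E n \<times> {..<k} \<times> {..<m})"
    and p_first: "e \<in> E n \<Longrightarrow> b < m \<Longrightarrow> p n e 0 b = \<phi> n (fst e)"
    and p_last: "e \<in> E n \<Longrightarrow> b < m \<Longrightarrow> p n e k b = \<phi> n (snd e)"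
    and inj_\<phi>: "inj_on (\<phi> n) (fst ` E n \<union> snd ` E n)"
    and inj_p: "inj_on (\<lambda>(e, i, b). p n e i b) (E n \<times> {0<..<k} \<times> {..<m})"
    and p_new: "e \<in> E n \<Longrightarrow> 0 < i \<Longrightarrow> i < k \<Longrightarrow> b < m \<Longrightarrow> p n e i b \<notin> \<phi> n ` (fst ` E n \<union> snd ` E n)"
begin

definition ends :: "nat \<Rightarrow> 'v set" where
  "ends n = fst ` E n \<union> snd ` E n"

definition child :: "nat \<Rightarrow> 'v \<times> 'v \<Rightarrow> nat \<Rightarrow> nat \<Rightarrow> 'v \<times> 'v" where
  "child n e i b = (p n e i b, p n e (Suc i) b)"

lemma fst_child [simp]: "fst (child n e i b) = p n e i b"
  and snd_child [simp]: "snd (child n e i b) = p n e (Suc i) b"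
  by (simp_all add: child_def)

lemma ends_I [intro]: "e \<in> E n \<Longrightarrow> fst e \<in> ends n" "e \<in> E n \<Longrightarrow> snd e \<in> ends n"
  by (auto simp: ends_def)

lemma p_eq_iff:
  assumes "e \<in> E n" "e' \<in> E n" "0 < i" "i < k" "0 < i'" "i' < k" "b < m" "b' < m"
  shows "p n e i b = p n e' i' b' \<longleftrightarrow> e = e' \<and> i = i' \<and> b = b'"
  using inj_onD[OF inj_p, of n "(e, i, b)" "(e', i', b')"] assms by auto

lemma p_neq_\<phi>:
  assumes "e \<in> E n" "0 < i" "i < k" "b < m" "v \<in> ends n"
  shows "p n e i b \<noteq> \<phi> n v"
  using p_new[OF assms(1-4)] assms(5) by (auto simp: ends_def)

lemma child_mem: "e \<in> E n \<Longrightarrow> i < k \<Longrightarrow> b < m \<Longrightarrow> child n e i b \<in> E (Suc n)"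
  by (force simp: E_Suc child_def)

lemma E_Suc_cases:
  assumes "e' \<in> E (Suc n)"
  obtains e i b where "e \<in> E n" "i < k" "b < m" "e' = child n e i b"
  using assms by (auto simp: E_Suc child_def)

text \<open>Since \<^term>\<open>k \<ge> 2\<close>, every edge of level \<^term>\<open>Suc n\<close> has an end that is not a vertex of
  level \<^term>\<open>n\<close>, and such an end determines the edge of level \<^term>\<open>n\<close> and the branch.\<close>

lemma child_inj:
  assumes "e \<in> E n" "e' \<in> E n" "i < k" "i' < k" "b < m" "b' < m"
    and eq: "child n e i b = child n e' i' b'"
  shows "e = e' \<and> i = i' \<and> b = b'"
proof (cases "i = 0")
  case True
  have "i' = 0"
    using eq assms p_neq_\<phi>[of e' n i' b' "fst e"] p_first[of e n b] True
    by (cases "i' = 0") (auto simp: child_def)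
  then show ?thesis
    using True eq assms k2 p_eq_iff[of e n e' 1 1 b b'] by (auto simp: child_def)
next
  case False
  have "i' \<noteq> 0"
    using eq assms p_neq_\<phi>[of e n i b "fst e'"] p_first[of e' n b'] False
    by (cases "i' = 0") (auto simp: child_def)
  then show ?thesis
    using False eq assms p_eq_iff[of e n e' i i' b b'] by (auto simp: child_def)
qed

lemma E_neq: "e \<in> E n \<Longrightarrow> fst e \<noteq> snd e"
proof (induction n arbitrary: e)
  case 0
  then show ?case using E_0 s_neq_t by simp
next
  case (Suc n)
  obtain d i b where d: "d \<in> E n" "i < k" "b < m" "e = child n d i b"
    using E_Suc_cases[OF Suc.prems] by metis
  show ?case
  proof (cases "i = 0")
    case True
    then show ?thesis
      using d k2 p_neq_\<phi>[of d n 1 b "fst d"] p_first[of d n b] by (auto dest: sym)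
  next
    case False
    then show ?thesis
      using d p_neq_\<phi>[of d n i b "snd d"] p_last[of d n b] p_eq_iff[of d n d i "Suc i" b b]
      by (cases "Suc i = k") auto
  qed
qed

lemma finite_E [simp]: "finite (E n)"
  by (induction n) (simp_all add: E_0 E_Suc)

lemma sum_E_Suc: "(\<Sum>e\<in>E (Suc n). g e) = (\<Sum>e\<in>E n. \<Sum>i<k. \<Sum>b<m. g (child n e i b))"
proof -
  have "inj_on (\<lambda>(e, i, b). child n e i b) (E n \<times> {..<k} \<times> {..<m})"
    by (rule inj_onI) (use child_inj in auto)
  moreover have "E (Suc n) = (\<lambda>(e, i, b). child n e i b) ` (E n \<times> {..<k} \<times> {..<m})"
    by (simp add: E_Suc child_def)
  ultimately have "(\<Sum>e\<in>E (Suc n). g e) = (\<Sum>(e, i, b)\<in>E n \<times> {..<k} \<times> {..<m}. g (child n e i b))"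
    by (simp add: sum.reindex case_prod_unfold)
  then show ?thesis
    by (simp add: sum.cartesian_product)
qed

lemma card_E: "card (E n) = (k * m) ^ n"
proof (induction n)
  case (Suc n)
  then show ?case using sum_E_Suc[of "\<lambda>_. 1::nat" n] by simp
qed (simp add: E_0)

text \<open>The composite of the \<open>\<phi>\<close> from level \<open>n\<close> to level
  \<open>n + r\<close>. Like \<open>dsum\<close> and \<open>affine\<close> below, it peels off the
  coarsest step first, so inductions on \<open>r\<close> vary \<open>n\<close>.\<close>

primrec emb :: "nat \<Rightarrow> nat \<Rightarrow> 'v \<Rightarrow> 'v" where
  "emb 0 n v = v"
| "emb (Suc r) n v = emb r (Suc n) (\<phi> n v)"

text \<open>The sum of \<open>X\<close> over those edges of level \<open>n + r\<close> that descend
  from the edge \<open>e\<close> of level \<open>n\<close>.\<close>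

primrec dsum :: "nat \<Rightarrow> ('v \<times> 'v \<Rightarrow> real) \<Rightarrow> nat \<Rightarrow> 'v \<times> 'v \<Rightarrow> real" where
  "dsum 0 X n e = X e"
| "dsum (Suc r) X n e = (\<Sum>i<k. \<Sum>b<m. dsum r X (Suc n) (child n e i b))"

lemma sum_dsum: "(\<Sum>e\<in>E n. dsum r X n e) = (\<Sum>e\<in>E (n + r). X e)"
proof (induction r arbitrary: n)
  case (Suc r)
  then show ?case using Suc[of "Suc n"] by (simp add: sum_E_Suc)
qed simp

lemma dsum_mono:
  assumes "e \<in> E n" "\<And>e. e \<in> E (n + r) \<Longrightarrow> X e \<le> Y e"
  shows "dsum r X n e \<le> dsum r Y n e"
  using assms
proof (induction r arbitrary: n e)
  case (Suc r)
  have "dsum r X (Suc n) (child n e i b) \<le> dsum r Y (Suc n) (child n e i b)"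
    if "i < k" "b < m" for i b
    by (rule Suc.IH) (use Suc.prems that in \<open>auto intro!: child_mem\<close>)
  then show ?case unfolding dsum.simps by (intro sum_mono) simp
qed simp

lemma dsum_nonneg:
  assumes "\<And>e. 0 \<le> X e" shows "0 \<le> dsum r X n e"
  by (induction r arbitrary: n e) (simp_all add: assms sum_nonneg)

lemma dsum_const: "dsum r (\<lambda>_. c) n e = real (k * m) ^ r * c"
  by (induction r arbitrary: n e) simp_all

lemma abs_dsum_le: "\<bar>dsum r X n e\<bar> \<le> dsum r (\<lambda>e. \<bar>X e\<bar>) n e"
proof (induction r arbitrary: n e)
  case (Suc r)
  have "\<bar>dsum (Suc r) X n e\<bar> \<le> (\<Sum>i<k. \<Sum>b<m. \<bar>dsum r X (Suc n) (child n e i b)\<bar>)"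
    by (auto intro!: order.trans[OF sum_abs] sum_mono)
  also have "\<dots> \<le> dsum (Suc r) (\<lambda>e. \<bar>X e\<bar>) n e"
    by (simp add: Suc sum_mono)
  finally show ?case .
qed simp

end

section \<open>Isoperimetry\<close>

context diamond_refinement
begin

definition cut :: "('v \<Rightarrow> bool) \<Rightarrow> 'v \<times> 'v \<Rightarrow> real" where
  "cut P e = of_bool (P (fst e) \<noteq> P (snd e))"

text \<open>Each edge gives half a unit to each end, so the average of \<open>mass\<close> over the
  edges is the degree-probability measure of the set.\<close>

definition mass :: "('v \<Rightarrow> bool) \<Rightarrow> 'v \<times> 'v \<Rightarrow> real" where
  "mass P e = (of_bool (P (fst e)) + of_bool (P (snd e))) / 2"

lemma cut_nonneg: "0 \<le> cut P e" by (simp add: cut_def)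
lemma mass_nonneg: "0 \<le> mass P e" by (simp add: mass_def)

text \<open>Each of the \<open>m\<close> branches of the outermost diamond joins two separated
  vertices, so it contains a copy with separated ends; the induction hypothesis is applied to one
  such copy per branch.\<close>

lemma dsum_cut_ge:
  assumes "e \<in> E n" "P (emb r n (fst e)) \<noteq> P (emb r n (snd e))"
  shows "real m ^ r \<le> dsum r (cut P) n e"
  using assms
proof (induction r arbitrary: n e)
  case (Suc r)
  have "real m ^ r \<le> (\<Sum>i<k. dsum r (cut P) (Suc n) (child n e i b))" if b: "b < m" for b
  proof -
    let ?f = "\<lambda>i. P (emb r (Suc n) (p n e i b))"
    have "?f 0 \<noteq> ?f k" using Suc.prems b by (simp add: p_first p_last)
    then obtain i where i: "i < k" "?f i \<noteq> ?f (Suc i)"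
      using neq_step[of ?f 0 k] by auto
    have "real m ^ r \<le> dsum r (cut P) (Suc n) (child n e i b)"
      using Suc.IH[OF child_mem[OF Suc.prems(1) i(1) b]] i(2) by simp
    also have "\<dots> \<le> (\<Sum>i<k. dsum r (cut P) (Suc n) (child n e i b))"
      using i by (intro member_le_sum) (auto intro: dsum_nonneg cut_nonneg)
    finally show ?thesis .
  qed
  then have "(\<Sum>b<m. real m ^ r) \<le> (\<Sum>b<m. \<Sum>i<k. dsum r (cut P) (Suc n) (child n e i b))"
    by (intro sum_mono) auto
  then show ?case
    by (subst dsum.simps(2), subst sum.swap) simp
qed (simp add: cut_def)

text \<open>This is \<open>(\<delta> - 1) / \<delta>\<close> for the dimension
  \<open>\<delta> = 1 + ln m / ln k\<close>.\<close>

definition \<alpha> :: real where "\<alpha> = ln (real m) / ln (real (k * m))"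

lemma km_gt_1: "1 < real (k * m)"
  using mult_le_mono[OF k2 m2] by linarith

lemma \<alpha>_pos: "0 < \<alpha>" and \<alpha>_le_1: "\<alpha> \<le> 1" and km_powr_\<alpha>: "real (k * m) powr \<alpha> = real m"
proof -
  have *: "0 < ln (real m)" "0 < ln (real (k * m))" using m2 km_gt_1 by auto
  then show "0 < \<alpha>" by (simp add: \<alpha>_def)
  have "m \<le> k * m" using k2 by simp
  then have "real m \<le> real (k * m)" by (simp only: of_nat_le_iff)
  then have "ln (real m) \<le> ln (real (k * m))"
    using m2 k2 by (subst ln_le_cancel_iff) auto
  then show "\<alpha> \<le> 1" using * by (simp add: \<alpha>_def)
  show "real (k * m) powr \<alpha> = real m"
    using * m2 k2 by (simp add: \<alpha>_def powr_def del: of_nat_mult)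
qed

lemma km_power_powr_\<alpha>: "(real (k * m) ^ r) powr \<alpha> = real m ^ r"
proof -
  have "(x ^ r) powr \<alpha> = (x powr \<alpha>) ^ r" if "0 < x" for x :: real
    using that by (induction r) (simp_all add: powr_mult)
  from this[of "real (k * m)"] have "(real (k * m) ^ r) powr \<alpha> = (real (k * m) powr \<alpha>) ^ r"
    using km_gt_1 by linarith
  then show ?thesis by (simp only: km_powr_\<alpha>)
qed

text \<open>If the set meets an interior vertex of the coarsest diamond, two copies on one branch are
  cut and the trivial bound on the mass suffices; otherwise the copies are treated separately.\<close>

lemma dsum_mass_powr_le:
  assumes "e \<in> E n" "\<not> P (emb r n (fst e))" "\<not> P (emb r n (snd e))"
  shows "dsum r (mass P) n e powr \<alpha> \<le> real m / 2 * dsum r (cut P) n e"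
  using assms
proof (induction r arbitrary: n e)
  \<comment> \<open>Both ends are outside, so the mass is 0, and
    \<open>0 powr \<alpha> = 0\<close>.\<close>
  case 0
  then show ?case by (simp add: mass_def cut_def)
next
  case (Suc r)
  let ?c = "\<lambda>i b. dsum r (cut P) (Suc n) (child n e i b)"
  let ?M = "\<lambda>i b. dsum r (mass P) (Suc n) (child n e i b)"
  let ?f = "\<lambda>b i. P (emb r (Suc n) (p n e i b))"
  show ?case
  proof (cases "\<exists>i\<le>k. \<exists>b<m. ?f b i")
    case True
    then obtain j b where j: "j \<le> k" "b < m" "?f b j" by auto
    have f0: "\<not> ?f b 0" "\<not> ?f b k" using Suc.prems j(2) by (simp_all add: p_first p_last)
    \<comment> \<open>The branch starts and ends outside the set but meets it at \<open>j\<close>: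
      there is a change before \<open>j\<close> and one from \<open>j\<close> on, in different
      copies.\<close>
    obtain i1 where i1: "i1 < j" "?f b i1 \<noteq> ?f b (Suc i1)"
      using neq_step[of "?f b" 0 j] f0 j by auto
    obtain i2 where i2: "j \<le> i2" "i2 < k" "?f b i2 \<noteq> ?f b (Suc i2)"
      using neq_step[of "?f b" j k] f0 j by auto
    have lt: "i1 < k" using i1 j by simp
    have "2 * real m ^ r \<le> ?c i1 b + ?c i2 b"
      using dsum_cut_ge[OF child_mem[OF Suc.prems(1) lt j(2)], of P r] i1(2)
            dsum_cut_ge[OF child_mem[OF Suc.prems(1) i2(2) j(2)], of P r] i2(3) by simp
    also have "\<dots> = (\<Sum>i\<in>{i1, i2}. ?c i b)" using i1 i2 by simp
    also have "\<dots> \<le> (\<Sum>i<k. ?c i b)"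
      using lt i2 by (intro sum_mono2) (auto intro: dsum_nonneg cut_nonneg)
    also have "\<dots> \<le> (\<Sum>b<m. \<Sum>i<k. ?c i b)"
      using j by (intro member_le_sum[of b _ "\<lambda>b. \<Sum>i<k. ?c i b"])
        (auto intro!: sum_nonneg dsum_nonneg cut_nonneg)
    also have "\<dots> = dsum (Suc r) (cut P) n e"
      by (subst sum.swap) simp
    finally have C: "2 * real m ^ r \<le> dsum (Suc r) (cut P) n e" .
    have "dsum (Suc r) (mass P) n e \<le> dsum (Suc r) (\<lambda>_. 1) n e"
      using Suc.prems(1) by (rule dsum_mono) (auto simp: mass_def)
    also have "\<dots> = real (k * m) ^ Suc r"
      using dsum_const[of "Suc r" 1 n e] by simp
    finally have "dsum (Suc r) (mass P) n e powr \<alpha> \<le> (real (k * m) ^ Suc r) powr \<alpha>"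
      using \<alpha>_pos by (intro powr_mono2) (auto intro!: dsum_nonneg mass_nonneg simp del: dsum.simps)
    also have "\<dots> = real m ^ Suc r" by (rule km_power_powr_\<alpha>)
    \<comment> \<open>The two cut copies account for the factor 2, hence for the constant
      \<open>m / 2\<close>.\<close>
    also have "\<dots> = real m / 2 * (2 * real m ^ r)" by simp
    also have "\<dots> \<le> real m / 2 * dsum (Suc r) (cut P) n e"
      using C by (intro mult_left_mono) auto
    finally show ?thesis .
  next
    case False
    \<comment> \<open>No vertex of the outermost diamond has its image in the set, so the induction
      hypothesis covers every copy.\<close>
    have IH: "?M i b powr \<alpha> \<le> real m / 2 * ?c i b" if "i < k" "b < m" for i b
      using that False by (intro Suc.IH child_mem Suc.prems) auto
    have "dsum (Suc r) (mass P) n e powr \<alpha> = (\<Sum>(i, b)\<in>{..<k} \<times> {..<m}. ?M i b) powr \<alpha>"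
      by (simp add: sum.cartesian_product)
    also have "\<dots> \<le> (\<Sum>x\<in>{..<k} \<times> {..<m}. (case x of (i, b) \<Rightarrow> ?M i b) powr \<alpha>)"
      by (rule powr_sum_le) (auto intro: dsum_nonneg mass_nonneg \<alpha>_pos \<alpha>_le_1)
    also have "\<dots> \<le> (\<Sum>(i, b)\<in>{..<k} \<times> {..<m}. real m / 2 * ?c i b)"
      by (rule sum_mono) (use IH in auto)
    also have "\<dots> = real m / 2 * dsum (Suc r) (cut P) n e"
      by (simp add: sum.cartesian_product[symmetric] sum_distrib_left)
    finally show ?thesis .
  qed
qed

lemma dsum_0_eq_sum: "dsum N X 0 (s, t) = (\<Sum>e\<in>E N. X e)"
  using sum_dsum[where n = 0 and r = N and X = X] by (simp add: E_0)

text \<open>A separated source and sink force \<open>m ^ N\<close> cut edges, while the left side is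
  at most 1. If both lie in the set, the complement is treated instead: it has the same cut edges
  and the complementary mass.\<close>

lemma isoperimetric_E:
  "min ((\<Sum>e\<in>E N. mass P e) / real (k * m) ^ N)
       (1 - (\<Sum>e\<in>E N. mass P e) / real (k * m) ^ N) powr \<alpha>
    \<le> real m / 2 * ((\<Sum>e\<in>E N. cut P e) / real m ^ N)" (is "min ?x ?y powr \<alpha> \<le> ?R")
proof -
  let ?M = "\<lambda>P. \<Sum>e\<in>E N. mass P e" and ?K = "real (k * m) ^ N"
  have K: "0 < ?K" using km_gt_1 by simp
  have m0: "0 < real m ^ N" using m2 by simp
  have not: "?M (\<lambda>v. \<not> P v) = ?K - ?M P"
  proof -
    have "?M (\<lambda>v. \<not> P v) + ?M P = (\<Sum>e\<in>E N. 1)"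
      unfolding sum.distrib[symmetric] by (rule sum.cong) (auto simp: mass_def)
    then show ?thesis by (simp add: card_E)
  qed
  have M0: "0 \<le> ?M P" for P by (intro sum_nonneg mass_nonneg)
  have x0: "0 \<le> ?x" and y0: "0 \<le> ?y"
    using M0[of P] M0[of "\<lambda>v. \<not> P v"] K not by (auto simp: field_simps)
  have main: "(?M Q / ?K) powr \<alpha> \<le> real m / 2 * ((\<Sum>e\<in>E N. cut Q e) / real m ^ N)"
    if "\<not> Q (emb N 0 s)" "\<not> Q (emb N 0 t)" for Q
  proof -
    have "?M Q powr \<alpha> \<le> real m / 2 * (\<Sum>e\<in>E N. cut Q e)"
      using dsum_mass_powr_le[of "(s, t)" 0 Q N] that by (simp add: E_0 dsum_0_eq_sum)
    then have "?M Q powr \<alpha> / real m ^ N \<le> real m / 2 * (\<Sum>e\<in>E N. cut Q e) / real m ^ N"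
      using m0 by (intro divide_right_mono) auto
    then show ?thesis
      using K M0[of Q] by (simp add: powr_divide km_power_powr_\<alpha> del: of_nat_mult)
  qed
  consider "P (emb N 0 s) \<noteq> P (emb N 0 t)" | "\<not> P (emb N 0 s)" "\<not> P (emb N 0 t)"
    | "P (emb N 0 s)" "P (emb N 0 t)" by auto
  then show ?thesis
  proof cases
    case 1
    have "real m ^ N \<le> (\<Sum>e\<in>E N. cut P e)"
      using dsum_cut_ge[of "(s, t)" 0 P N] 1 by (simp add: E_0 dsum_0_eq_sum)
    then have "1 \<le> (\<Sum>e\<in>E N. cut P e) / real m ^ N" using m0 by simp
    then have "1 * 1 \<le> ?R" using m2 by (intro mult_mono) auto
    moreover have "min ?x ?y powr \<alpha> \<le> 1"
      using x0 y0 \<alpha>_pos by (intro powr_le1) auto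
    ultimately show ?thesis by simp
  next
    case 2
    have "min ?x ?y powr \<alpha> \<le> ?x powr \<alpha>"
      using x0 y0 \<alpha>_pos by (intro powr_mono2) auto
    then show ?thesis using main[OF 2] by simp
  next
    case 3
    have "min ?x ?y powr \<alpha> \<le> ?y powr \<alpha>"
      using x0 y0 \<alpha>_pos by (intro powr_mono2) auto
    also have "?y powr \<alpha> = (?M (\<lambda>v. \<not> P v) / ?K) powr \<alpha>"
      using k2 m2 by (simp add: not diff_divide_distrib)
    also have "\<dots> \<le> ?R"
      using main[of "\<lambda>v. \<not> P v"] 3 by (simp add: cut_def)
    finally show ?thesis .
  qed
qed

end

section \<open>Orthogonal functions\<close>

context diamond_refinement
begin

section \<open>Affine extension to finer levels\<close>

text \<open>Glues the values \<open>g\<close> at the old vertices and \<open>c e i b\<close> at the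
  new ones. Injectivity and disjointness in the locale make both inverses correct there; elsewhere
  the value is arbitrary.\<close>

definition lift :: "nat \<Rightarrow> ('v \<times> 'v \<Rightarrow> nat \<Rightarrow> nat \<Rightarrow> real) \<Rightarrow> ('v \<Rightarrow> real) \<Rightarrow> 'v \<Rightarrow> real" where
  "lift n c g x =
    (if x \<in> \<phi> n ` ends n then g (inv_into (ends n) (\<phi> n) x)
     else case inv_into (E n \<times> {0<..<k} \<times> {..<m}) (\<lambda>(e, i, b). p n e i b) x of (e, i, b) \<Rightarrow> c e i b)"

lemma lift_\<phi>: "v \<in> ends n \<Longrightarrow> lift n c g (\<phi> n v) = g v"
  using inj_\<phi>[of n] by (simp add: lift_def inv_into_f_f ends_def)

lemma lift_p:
  assumes "e \<in> E n" "0 < i" "i < k" "b < m"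
  shows "lift n c g (p n e i b) = c e i b"
  using p_neq_\<phi>[OF assms] inv_into_f_f[OF inj_p, of "(e, i, b)" n] assms
  by (auto simp: lift_def)

definition interp :: "real \<Rightarrow> real \<Rightarrow> nat \<Rightarrow> real" where
  "interp x y i = x + real i / real k * (y - x)"

text \<open>The values do not depend on the branch \<open>b\<close>; this makes the extensions
  orthogonal to the bumps of the same level.\<close>

definition refine :: "nat \<Rightarrow> ('v \<Rightarrow> real) \<Rightarrow> 'v \<Rightarrow> real" where
  "refine n g = lift n (\<lambda>e i b. interp (g (fst e)) (g (snd e)) i) g"

lemma refine_p:
  assumes "e \<in> E n" "i \<le> k" "b < m"
  shows "refine n g (p n e i b) = interp (g (fst e)) (g (snd e)) i"
proof -
  consider "i = 0" | "i = k" | "0 < i" "i < k" using assms(2) by linarith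
  then show ?thesis
    using assms k2
    by cases (auto simp: refine_def lift_p lift_\<phi> ends_I p_first p_last interp_def)
qed

primrec affine :: "nat \<Rightarrow> nat \<Rightarrow> ('v \<Rightarrow> real) \<Rightarrow> 'v \<Rightarrow> real" where
  "affine 0 n g = g"
| "affine (Suc r) n g = affine r (Suc n) (refine n g)"

lemma affine_add: "affine (r + q) n g = affine q (n + r) (affine r n g)"
  by (induction r arbitrary: n g) simp_all

lemma ends_Suc_cases:
  assumes "v \<in> ends (Suc n)"
  obtains e i b where "e \<in> E n" "i \<le> k" "b < m" "v = p n e i b"
proof -
  obtain e' where e': "e' \<in> E (Suc n)" "v = fst e' \<or> v = snd e'"
    using assms by (auto simp: ends_def)
  obtain e i b where *: "e \<in> E n" "i < k" "b < m" "e' = child n e i b"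
    using E_Suc_cases[OF e'(1)] by metis
  then show ?thesis using e'(2) that[of e i b] that[of e "Suc i" b] by auto
qed

text \<open>One refinement divides the increment along an edge by \<open>k\<close>.\<close>

lemma affine_diff_le:
  assumes "\<And>e. e \<in> E n \<Longrightarrow> \<bar>g (fst e) - g (snd e)\<bar> \<le> B" "e \<in> E (n + r)"
  shows "\<bar>affine r n g (fst e) - affine r n g (snd e)\<bar> \<le> B / real k ^ r"
  using assms
proof (induction r arbitrary: n g B)
  case (Suc r)
  have "\<bar>refine n g (fst e') - refine n g (snd e')\<bar> \<le> B / real k" if e': "e' \<in> E (Suc n)" for e'
  proof -
    obtain d i b where d: "d \<in> E n" "i < k" "b < m" "e' = child n d i b"
      using E_Suc_cases[OF e'] by metis
    then have "refine n g (fst e') - refine n g (snd e') = (g (fst d) - g (snd d)) / real k"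
      using k2 by (simp add: refine_p interp_def field_simps)
    then show ?thesis
      using Suc.prems(1)[OF d(1)] by (simp add: divide_right_mono)
  qed
  then show ?case
    using Suc.IH[of "Suc n" "refine n g" "B / real k"] Suc.prems(2) by (simp add: field_simps)
qed simp

text \<open>Interpolated values are convex combinations of the values at the ends.\<close>

lemma affine_bounded:
  assumes "\<And>v. v \<in> ends n \<Longrightarrow> \<bar>g v\<bar> \<le> 1" "v \<in> ends (n + r)"
  shows "\<bar>affine r n g v\<bar> \<le> 1"
  using assms
proof (induction r arbitrary: n g)
  case (Suc r)
  have "\<bar>refine n g v'\<bar> \<le> 1" if v': "v' \<in> ends (Suc n)" for v'
  proof -
    obtain e i b where e: "e \<in> E n" "i \<le> k" "b < m" "v' = p n e i b"
      using ends_Suc_cases[OF v'] by metis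
    define q where "q = real i / real k"
    have q: "0 \<le> q" "q \<le> 1" using e k2 by (auto simp: q_def)
    have "\<bar>refine n g v'\<bar> = \<bar>(1 - q) * g (fst e) + q * g (snd e)\<bar>"
      using e by (simp add: refine_p interp_def q_def algebra_simps)
    also have "\<dots> \<le> (1 - q) * \<bar>g (fst e)\<bar> + q * \<bar>g (snd e)\<bar>"
      using q by (intro order.trans[OF abs_triangle_ineq]) (simp add: abs_mult)
    also have "\<dots> \<le> (1 - q) * 1 + q * 1"
      using q e Suc.prems(1) by (intro add_mono mult_left_mono) auto
    finally show ?thesis by simp
  qed
  then show ?case
    using Suc.IH[of "Suc n" "refine n g"] Suc.prems(2) by simp
qed simp

text \<open>The trapezoidal rule is exact for affine functions.\<close>

lemma sum_interp: "(\<Sum>i<k. interp x y i + interp x y (Suc i)) = real k * (x + y)"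
proof -
  let ?c = "(y - x) / real k"
  \<comment> \<open>The first \<open>j\<close> odd numbers \<open>2 * i + 1\<close> add up to
    \<open>j * j\<close>.\<close>
  have "(\<Sum>i<j. 2 * x + (2 * real i + 1) * c) = real j * (2 * x) + real j * real j * c" for j c
    by (induction j) (simp_all add: algebra_simps)
  moreover have "interp x y i + interp x y (Suc i) = 2 * x + (2 * real i + 1) * ?c" for i
    by (simp add: interp_def algebra_simps add_divide_distrib)
  ultimately have "(\<Sum>i<k. interp x y i + interp x y (Suc i)) = real k * (2 * x) + real k * real k * ?c"
    by (simp only:)
  also have "\<dots> = real k * (x + y)"
    using k2 by (simp add: field_simps)
  finally show ?thesis .
qed

text \<open>Each refinement multiplies the sum of the two end values by \<open>k * m\<close>: by
  \<open>sum_interp\<close>, every one of the \<open>m\<close> branches contributes \<open>k\<close>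
  times that sum.\<close>

lemma dsum_affine:
  assumes "e \<in> E n"
  shows "dsum r (\<lambda>e. affine r n g (fst e) + affine r n g (snd e)) n e
    = real (k * m) ^ r * (g (fst e) + g (snd e))"
  using assms
proof (induction r arbitrary: n e g)
  case (Suc r)
  have "dsum (Suc r) (\<lambda>e. affine (Suc r) n g (fst e) + affine (Suc r) n g (snd e)) n e
      = (\<Sum>i<k. \<Sum>b<m. real (k * m) ^ r *
          (interp (g (fst e)) (g (snd e)) i + interp (g (fst e)) (g (snd e)) (Suc i)))"
    using Suc.prems by (auto simp: Suc.IH child_mem refine_p intro!: sum.cong)
  also have "\<dots> = real (k * m) ^ r * m *
      (\<Sum>i<k. interp (g (fst e)) (g (snd e)) i + interp (g (fst e)) (g (snd e)) (Suc i))"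
    by (simp add: sum_distrib_left mult_ac)
  finally show ?case by (simp add: sum_interp mult_ac)
qed simp

section \<open>Inner products of affine extensions\<close>

text \<open>The inner product, over one copy, of the \<open>r\<close>-fold affine extensions with
  end values \<open>a\<close>, \<open>b\<close> and \<open>c\<close>, \<open>d\<close>. It depends
  on these four numbers alone, so signs can be pulled out. The factor \<open>m\<close> counts the
  branches, which carry equal values.\<close>

primrec affine_inner :: "nat \<Rightarrow> real \<Rightarrow> real \<Rightarrow> real \<Rightarrow> real \<Rightarrow> real" where
  "affine_inner 0 a b c d = a * c + b * d"
| "affine_inner (Suc r) a b c d = (\<Sum>i<k. real m *
     affine_inner r (interp a b i) (interp a b (Suc i)) (interp c d i) (interp c d (Suc i)))"

text \<open>Summed over all edges of level \<open>N\<close>, this is \<open>2 * (k * m) ^ N\<close>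
  times the inner product for the degree-probability measure.\<close>

definition edge_inner :: "('v \<Rightarrow> real) \<Rightarrow> ('v \<Rightarrow> real) \<Rightarrow> 'v \<times> 'v \<Rightarrow> real" where
  "edge_inner g h e = g (fst e) * h (fst e) + g (snd e) * h (snd e)"

lemma dsum_edge_inner:
  assumes "e \<in> E n"
  shows "dsum r (edge_inner (affine r n g) (affine r n h)) n e
    = affine_inner r (g (fst e)) (g (snd e)) (h (fst e)) (h (snd e))"
  using assms
proof (induction r arbitrary: n e g h)
  case (Suc r)
  then show ?case by (auto simp: child_mem refine_p intro!: sum.cong)
qed (simp add: edge_inner_def)

lemma affine_inner_scale:
  "affine_inner r (x * a) (x * b) (y * c) (y * d) = x * y * affine_inner r a b c d"
proof (induction r arbitrary: a b c d)
  case (Suc r)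
  have *: "interp (z * u) (z * w) i = z * interp u w i" for z u w i
    by (simp add: interp_def algebra_simps diff_divide_distrib)
  show ?case unfolding affine_inner.simps * Suc sum_distrib_left by (simp add: mult_ac)
qed (simp add: algebra_simps)

section \<open>Bumps on paired branches\<close>

text \<open>For odd \<^term>\<open>m\<close> the last branch has no partner and gets the sign 0.\<close>

definition branch_sign :: "nat \<Rightarrow> real" where
  "branch_sign b = (if b < 2 * (m div 2) then (-1) ^ b else 0)"

lemma sum_branch_sign: "(\<Sum>b<m. branch_sign b) = 0"
  and sum_abs_branch_sign: "(\<Sum>b<m. \<bar>branch_sign b\<bar>) = 2 * real (m div 2)"
proof -
  let ?q = "2 * (m div 2)"
  have restrict: "(\<Sum>b<m. if b < ?q then F b else 0) = (\<Sum>b<?q. F b)" for F :: "nat \<Rightarrow> real"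
    by (rule sum.mono_neutral_cong_right) auto
  have "(\<Sum>b<2 * j. (-1) ^ b) = (0 :: real)" for j by (induction j) auto
  then show "(\<Sum>b<m. branch_sign b) = 0"
    by (simp add: branch_sign_def restrict)
  have "\<bar>branch_sign b\<bar> = (if b < ?q then 1 else 0)" for b
    by (simp add: branch_sign_def power_abs)
  then show "(\<Sum>b<m. \<bar>branch_sign b\<bar>) = 2 * real (m div 2)"
    using restrict[of "\<lambda>_. 1"] by simp
qed

definition inner_bit :: "nat \<Rightarrow> real" where
  "inner_bit i = of_bool (0 < i \<and> i < k)"

text \<open>Bumps vanish at the old vertices, so the signs \<open>\<epsilon> e\<close> of different
  diamonds can be chosen independently.\<close>

definition bump :: "nat \<Rightarrow> ('v \<times> 'v \<Rightarrow> real) \<Rightarrow> 'v \<Rightarrow> real" where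
  "bump n \<epsilon> = lift n (\<lambda>e i b. \<epsilon> e * branch_sign b) (\<lambda>_. 0)"

lemma bump_p:
  assumes "e \<in> E n" "i \<le> k" "b < m"
  shows "bump n \<epsilon> (p n e i b) = \<epsilon> e * branch_sign b * inner_bit i"
proof -
  consider "i = 0" | "i = k" | "0 < i" "i < k" using assms(2) by linarith
  then show ?thesis
    using assms k2
    by cases (auto simp: bump_def lift_p lift_\<phi> ends_I p_first p_last inner_bit_def)
qed

lemma abs_branch_sign_le: "\<bar>branch_sign b\<bar> \<le> 1"
  by (simp add: branch_sign_def power_abs)

lemma bump_bounded:
  assumes "\<And>e. \<bar>\<epsilon> e\<bar> \<le> 1" "v \<in> ends (Suc n)"
  shows "\<bar>bump n \<epsilon> v\<bar> \<le> 1"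
proof -
  obtain e i b where e: "e \<in> E n" "i \<le> k" "b < m" "v = p n e i b"
    using ends_Suc_cases[OF assms(2)] by metis
  have "\<bar>bump n \<epsilon> v\<bar> = \<bar>\<epsilon> e\<bar> * \<bar>branch_sign b\<bar> * \<bar>inner_bit i\<bar>"
    using e by (simp add: bump_p abs_mult)
  also have "\<dots> \<le> 1 * 1 * 1"
    using assms(1) abs_branch_sign_le by (intro mult_mono) (auto simp: inner_bit_def)
  finally show ?thesis by simp
qed

text \<open>Both ends of an edge lie on one branch, where the only values are 0 and
  \<open>\<epsilon> d * branch_sign b\<close>; opposite signs never meet.\<close>

lemma bump_diff_le:
  assumes "\<And>e. \<bar>\<epsilon> e\<bar> \<le> 1" "e \<in> E (Suc n)"
  shows "\<bar>bump n \<epsilon> (fst e) - bump n \<epsilon> (snd e)\<bar> \<le> 1"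
proof -
  obtain d i b where d: "d \<in> E n" "i < k" "b < m" "e = child n d i b"
    using E_Suc_cases[OF assms(2)] by metis
  have "\<bar>bump n \<epsilon> (fst e) - bump n \<epsilon> (snd e)\<bar>
      = \<bar>\<epsilon> d\<bar> * \<bar>branch_sign b\<bar> * \<bar>inner_bit i - inner_bit (Suc i)\<bar>"
    using d by (simp add: bump_p right_diff_distrib[symmetric] abs_mult)
  also have "\<dots> \<le> 1 * 1 * 1"
    using assms(1) abs_branch_sign_le by (intro mult_mono) (auto simp: inner_bit_def)
  finally show ?thesis by simp
qed

text \<open>The contribution of the diamond on \<open>e\<close> is
  \<open>\<epsilon> e * \<epsilon>' e\<close> times a factor common to all diamonds.\<close>

lemma sum_edge_inner_bump:
  assumes "(\<Sum>e\<in>E n. \<epsilon> e * \<epsilon>' e) = 0"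
  shows "(\<Sum>e\<in>E (Suc n + r). edge_inner (affine r (Suc n) (bump n \<epsilon>)) (affine r (Suc n) (bump n \<epsilon>')) e) = 0"
proof -
  let ?g = "affine r (Suc n) (bump n \<epsilon>)" and ?h = "affine r (Suc n) (bump n \<epsilon>')"
  let ?w = "\<lambda>b i. branch_sign b * inner_bit i"
  have "(\<Sum>e\<in>E (Suc n + r). edge_inner ?g ?h e)
      = (\<Sum>e\<in>E n. \<Sum>i<k. \<Sum>b<m. dsum r (edge_inner ?g ?h) (Suc n) (child n e i b))"
    by (simp only: sum_dsum[symmetric] sum_E_Suc)
  also have "\<dots> = (\<Sum>e\<in>E n. \<Sum>i<k. \<Sum>b<m. \<epsilon> e * \<epsilon>' e *
      affine_inner r (?w b i) (?w b (Suc i)) (?w b i) (?w b (Suc i)))"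
    by (intro sum.cong refl)
      (simp add: dsum_edge_inner child_mem bump_p mult.assoc affine_inner_scale)
  also have "\<dots> = (\<Sum>e\<in>E n. \<epsilon> e * \<epsilon>' e) *
      (\<Sum>i<k. \<Sum>b<m. affine_inner r (?w b i) (?w b (Suc i)) (?w b i) (?w b (Suc i)))"
    by (subst sum_distrib_right) (simp only: sum_distrib_left)
  finally show ?thesis using assms by simp
qed

text \<open>An affine function does not distinguish the branches, while the signs of the bumps on the
  branches of a diamond add up to 0.\<close>

lemma sum_edge_inner_affine_bump:
  "(\<Sum>e\<in>E (Suc n + r). edge_inner (affine (Suc r) n g) (affine r (Suc n) (bump n \<epsilon>)) e) = 0"
proof -
  let ?g = "affine r (Suc n) (refine n g)" and ?h = "affine r (Suc n) (bump n \<epsilon>)"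
  let ?a = "\<lambda>e. interp (g (fst e)) (g (snd e))"
  have scale: "affine_inner r a b (y * c) (y * d) = y * affine_inner r a b c d" for a b c d y
    using affine_inner_scale[of r 1 a b y c d] by simp
  have "(\<Sum>e\<in>E (Suc n + r). edge_inner ?g ?h e)
      = (\<Sum>e\<in>E n. \<Sum>i<k. \<Sum>b<m. dsum r (edge_inner ?g ?h) (Suc n) (child n e i b))"
    by (simp only: sum_dsum[symmetric] sum_E_Suc)
  also have "\<dots> = (\<Sum>e\<in>E n. \<Sum>i<k. \<Sum>b<m. \<epsilon> e * branch_sign b *
      affine_inner r (?a e i) (?a e (Suc i)) (inner_bit i) (inner_bit (Suc i)))"
    by (intro sum.cong refl)
      (simp add: dsum_edge_inner child_mem bump_p refine_p scale)
  \<comment> \<open>Apart from the branch sign the summand is independent of \<open>b\<close>, so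
    the signs are summed first.\<close>
  also have "\<dots> = (\<Sum>e\<in>E n. \<Sum>i<k. (\<Sum>b<m. branch_sign b) * (\<epsilon> e *
      affine_inner r (?a e i) (?a e (Suc i)) (inner_bit i) (inner_bit (Suc i))))"
    by (simp only: sum_distrib_right sum_distrib_left mult_ac)
  finally show ?thesis by (simp add: sum_branch_sign)
qed

text \<open>Each of the \<open>k - 1\<close> interior positions is counted twice, as an end of two
  consecutive edges.\<close>

lemma sum_inner_bit: "(\<Sum>i<k. inner_bit i + inner_bit (Suc i)) = 2 * (real k - 1)"
proof -
  have k: "Suc (k - 1) = k" using k2 by simp
  have "(\<Sum>i<k - 1. inner_bit (Suc i)) = (\<Sum>i<k - 1. 1)"
    by (rule sum.cong) (auto simp: inner_bit_def)
  moreover have "(\<Sum>i<k. inner_bit i) = inner_bit 0 + (\<Sum>i<k - 1. inner_bit (Suc i))"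
    using sum.lessThan_Suc_shift[of inner_bit "k - 1"] by (simp only: k)
  moreover have "(\<Sum>i<k. inner_bit (Suc i)) = (\<Sum>i<k - 1. inner_bit (Suc i)) + inner_bit k"
    using sum.lessThan_Suc[of "\<lambda>i. inner_bit (Suc i)" "k - 1"] by (simp only: k)
  ultimately show ?thesis
    using k2 by (simp add: sum.distrib of_nat_diff inner_bit_def)
qed

text \<open>By the triangle inequality on each copy replacing an edge of level \<open>Suc n\<close>,
  it suffices to evaluate signed sums, which \<open>dsum_affine\<close> does. Each diamond has
  \<open>2 * (m div 2)\<close> signed branches, and along each of them the profile sums to
  \<open>2 * (k - 1)\<close>.\<close>

lemma sum_abs_bump_ge:
  "real (k * m) ^ r * (4 * real (m div 2) * (real k - 1)) * (\<Sum>e\<in>E n. \<bar>\<epsilon> e\<bar>)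
    \<le> (\<Sum>e\<in>E (Suc n + r). \<bar>affine r (Suc n) (bump n \<epsilon>) (fst e)\<bar> + \<bar>affine r (Suc n) (bump n \<epsilon>) (snd e)\<bar>)"
proof -
  let ?h = "affine r (Suc n) (bump n \<epsilon>)"
  let ?K = "real (k * m) ^ r"
  have "\<bar>dsum r (\<lambda>e. ?h (fst e) + ?h (snd e)) (Suc n) (child n e i b)\<bar>
      = ?K * (\<bar>\<epsilon> e\<bar> * \<bar>branch_sign b\<bar> * (inner_bit i + inner_bit (Suc i)))"
    if "e \<in> E n" "i < k" "b < m" for e i b
  proof -
    have "dsum r (\<lambda>e. ?h (fst e) + ?h (snd e)) (Suc n) (child n e i b)
      = ?K * (\<epsilon> e * branch_sign b * (inner_bit i + inner_bit (Suc i)))"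
      using that by (simp add: dsum_affine child_mem bump_p distrib_left)
    then show ?thesis by (simp add: abs_mult inner_bit_def)
  qed
  then have "(\<Sum>e\<in>E (Suc n). \<bar>dsum r (\<lambda>e. ?h (fst e) + ?h (snd e)) (Suc n) e\<bar>)
      = (\<Sum>e\<in>E n. \<Sum>i<k. \<Sum>b<m. ?K * (\<bar>\<epsilon> e\<bar> * \<bar>branch_sign b\<bar> * (inner_bit i + inner_bit (Suc i))))"
    by (simp add: sum_E_Suc)
  also have "\<dots> = ?K * ((\<Sum>b<m. \<bar>branch_sign b\<bar>) * (\<Sum>i<k. inner_bit i + inner_bit (Suc i)) * (\<Sum>e\<in>E n. \<bar>\<epsilon> e\<bar>))"
    by (simp only: sum_distrib_left[symmetric] sum_distrib_right[symmetric] mult_ac)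
  also have "\<dots> = ?K * (4 * real (m div 2) * (real k - 1)) * (\<Sum>e\<in>E n. \<bar>\<epsilon> e\<bar>)"
    by (simp add: sum_abs_branch_sign sum_inner_bit)
  finally have "?K * (4 * real (m div 2) * (real k - 1)) * (\<Sum>e\<in>E n. \<bar>\<epsilon> e\<bar>)
      = (\<Sum>e\<in>E (Suc n). \<bar>dsum r (\<lambda>e. ?h (fst e) + ?h (snd e)) (Suc n) e\<bar>)" ..
  also have "\<dots> \<le> (\<Sum>e\<in>E (Suc n). dsum r (\<lambda>e. \<bar>?h (fst e)\<bar> + \<bar>?h (snd e)\<bar>) (Suc n) e)"
    by (intro sum_mono order.trans[OF abs_dsum_le] dsum_mono) auto
  also have "\<dots> = (\<Sum>e\<in>E (Suc n + r). \<bar>?h (fst e)\<bar> + \<bar>?h (snd e)\<bar>)"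
    by (rule sum_dsum)
  finally show ?thesis .
qed

section \<open>Assembly of the orthogonal family\<close>

text \<open>Index \<open>(0, 0)\<close> is the constant 1, and \<open>(Suc n, i)\<close> is the bump
  function of level \<open>n\<close> for the \<open>i\<close>-th sign vector, extended to level
  \<open>N\<close>. The first component is the exponent in the Lipschitz bound; its shift by one is
  the reason for the divisor \<open>k * m\<close> in the count.\<close>

lemma spectral_E:
  obtains I :: "(nat \<times> nat) set" and F :: "nat \<times> nat \<Rightarrow> 'v \<Rightarrow> real" where
    "finite I"
    "\<And>x v. x \<in> I \<Longrightarrow> v \<in> ends N \<Longrightarrow> \<bar>F x v\<bar> \<le> 1"
    "\<And>x. x \<in> I \<Longrightarrow> real (k * m) ^ N / 3 \<le> (\<Sum>e\<in>E N. \<bar>F x (fst e)\<bar> + \<bar>F x (snd e)\<bar>)"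
    "\<And>x y. x \<in> I \<Longrightarrow> y \<in> I \<Longrightarrow> x \<noteq> y \<Longrightarrow> (\<Sum>e\<in>E N. edge_inner (F x) (F y) e) = 0"
    "\<And>x e. x \<in> I \<Longrightarrow> e \<in> E N \<Longrightarrow> \<bar>F x (fst e) - F x (snd e)\<bar> \<le> real k ^ fst x / real k ^ N"
    "\<And>n. n \<le> N \<Longrightarrow> real (k * m) ^ n / real (k * m) \<le> 2 * real (card {x \<in> I. fst x = n})"
proof -
  have km: "0 < k * m" using k2 m2 by simp
  define signs where "signs n M v \<longleftrightarrow> card (E n) < 2 * M \<and>
    (\<forall>i<M. (\<forall>x. \<bar>v i x\<bar> \<le> 1) \<and> (\<Sum>x\<in>E n. \<bar>v i x\<bar>) = real M) \<and>
    (\<forall>i<M. \<forall>j<M. i \<noteq> j \<longrightarrow> (\<Sum>x\<in>E n. v i x * v j x) = 0)"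
    for n M and v :: "nat \<Rightarrow> 'v \<times> 'v \<Rightarrow> real"
  have "E n \<noteq> {}" for n
    using km card_E[of n] by (metis card.empty less_irrefl zero_less_power)
  then have "\<exists>M v. signs n M v" for n
    unfolding signs_def by (intro ex_orthogonal_signs finite_E)
  then obtain M v where Mv: "\<And>n. signs n (M n) (v n)"
    by metis
  have M: "(k * m) ^ n < 2 * M n" for n using Mv[of n] unfolding signs_def card_E by blast
  have v: "\<bar>v n i e\<bar> \<le> 1" "(\<Sum>e\<in>E n. \<bar>v n i e\<bar>) = real (M n)" if "i < M n" for n i e
    using Mv[of n] that unfolding signs_def by blast+
  have v_orth: "(\<Sum>e\<in>E n. v n i e * v n j e) = 0" if "i < M n" "j < M n" "i \<noteq> j" for n i j
    using Mv[of n] that unfolding signs_def by blast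
  define g where "g x = (case x of (0, i) \<Rightarrow> (\<lambda>_. 1) | (Suc n, i) \<Rightarrow> bump n (v n i))" for x :: "nat \<times> nat"
  define F where "F x = affine (N - fst x) (fst x) (g x)" for x
  define I where "I = insert (0, 0) (Sigma {1..N} (\<lambda>n. {..<M (n - 1)}))"
  have I_cases: "x = (0, 0) \<or> (\<exists>n r i. x = (Suc n, i) \<and> i < M n \<and> N = Suc n + r)" if "x \<in> I" for x
    using that unfolding I_def by (cases "fst x") (auto simp: le_iff_add)
  have F_0: "F (0, i) = affine N 0 (\<lambda>_. 1)" for i
    by (simp add: F_def g_def)
  have F_Suc: "F (Suc n, i) = affine r (Suc n) (bump n (v n i))" if "N = Suc n + r" for n i r
    using that by (simp add: F_def g_def)
  show ?thesis
  proof
    show "finite I" by (simp add: I_def)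
  next
    fix x w assume x: "x \<in> I" and w: "w \<in> ends N"
    from I_cases[OF x] show "\<bar>F x w\<bar> \<le> 1"
    proof (elim disjE exE conjE)
      assume "x = (0, 0)"
      then show ?thesis using w by (auto simp: F_0 intro!: affine_bounded[where n = 0])
    next
      fix n r i assume *: "x = (Suc n, i)" "i < M n" "N = Suc n + r"
      then show ?thesis
        using w v(1) by (simp add: F_Suc[OF *(3)])
          (auto intro!: affine_bounded[where n = "Suc n" and r = r] bump_bounded)
    qed
  next
    fix x e assume x: "x \<in> I" and e: "e \<in> E N"
    from I_cases[OF x] show "\<bar>F x (fst e) - F x (snd e)\<bar> \<le> real k ^ fst x / real k ^ N"
    proof (elim disjE exE conjE)
      assume "x = (0, 0)"
      moreover have "\<bar>affine N 0 (\<lambda>_. 1) (fst e) - affine N 0 (\<lambda>_. 1) (snd e)\<bar> \<le> 0 / real k ^ N"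
        using e by (intro affine_diff_le[where n = 0]) auto
      ultimately show ?thesis by (simp add: F_0)
    next
      fix n r i assume *: "x = (Suc n, i)" "i < M n" "N = Suc n + r"
      have "\<bar>F x (fst e) - F x (snd e)\<bar> \<le> 1 / real k ^ r"
        using e * v(1) unfolding *(1) F_Suc[OF *(3)]
        by (intro affine_diff_le[where n = "Suc n"] bump_diff_le) auto
      then show ?thesis using * k2 by (simp add: power_add)
    qed
  next
    fix x assume x: "x \<in> I"
    from I_cases[OF x]
    show "real (k * m) ^ N / 3 \<le> (\<Sum>e\<in>E N. \<bar>F x (fst e)\<bar> + \<bar>F x (snd e)\<bar>)"
    proof (elim disjE exE conjE)
      assume x0: "x = (0, 0)"
      let ?h = "affine N 0 (\<lambda>_. 1)"
      have "real (k * m) ^ N * 2 = (\<Sum>e\<in>E N. ?h (fst e) + ?h (snd e))"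
        unfolding dsum_0_eq_sum[symmetric] by (subst dsum_affine) (simp_all add: E_0)
      also have "\<dots> \<le> (\<Sum>e\<in>E N. \<bar>?h (fst e)\<bar> + \<bar>?h (snd e)\<bar>)"
        by (intro sum_mono add_mono) auto
      moreover have "0 \<le> real (k * m) ^ N" by simp
      ultimately show ?thesis unfolding x0 F_0 by linarith
    next
      fix n r i assume *: "x = (Suc n, i)" "i < M n" "N = Suc n + r"
      \<comment> \<open>The bounds \<open>m \<le> 3 * (m div 2)\<close> (tight for
        \<open>m = 3\<close>), \<open>k \<le> 2 * (k - 1)\<close> (tight for \<open>k = 2\<close>)
        and \<open>(k * m) ^ n \<le> 2 * M n\<close> cost a factor 12 together; the 4 in
        \<open>sum_abs_bump_ge\<close> leaves one third.\<close>
      have "m \<le> 3 * (m div 2)" using m2 by presburger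
      then have "real m \<le> 3 * real (m div 2)" by (metis of_nat_le_iff of_nat_mult of_nat_numeral)
      then have "real m * real k \<le> (3 * real (m div 2)) * (2 * (real k - 1))"
        using k2 by (intro mult_mono) auto
      moreover have "real (k * m) ^ n \<le> 2 * real (M n)"
        using M[of n] by (metis less_imp_le of_nat_le_iff of_nat_mult of_nat_numeral of_nat_power)
      ultimately have "(real m * real k) * real (k * m) ^ n
          \<le> ((3 * real (m div 2)) * (2 * (real k - 1))) * (2 * real (M n))"
        by (rule mult_mono) (use k2 in auto)
      then have "real (k * m) ^ r * ((real m * real k) * real (k * m) ^ n / 3)
          \<le> real (k * m) ^ r * ((4 * real (m div 2) * (real k - 1)) * real (M n))"
        by (intro mult_left_mono) (auto simp: algebra_simps)
      also have "\<dots> \<le> (\<Sum>e\<in>E N. \<bar>F x (fst e)\<bar> + \<bar>F x (snd e)\<bar>)"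
        using sum_abs_bump_ge[where r = r and n = n and \<epsilon> = "v n i"] v(2)[OF *(2)]
        unfolding *(1) F_Suc[OF *(3)] by (simp add: *(3) mult_ac)
      finally show ?thesis by (simp add: *(3) power_add mult_ac)
    qed
  next
    have less: "(\<Sum>e\<in>E N. edge_inner (F x) (F y) e) = 0"
      if x: "x \<in> I" and y: "y \<in> I" and lt: "fst x < fst y" for x y
    proof -
      obtain n r i where *: "y = (Suc n, i)" "i < M n" "N = Suc n + r"
        using I_cases[OF y] lt by auto
      \<comment> \<open>The function of lower index is first extended to level \<open>n\<close> and
        then affinely through the diamonds that carry the bumps of \<open>y\<close>.\<close>
      have "N - fst x = n - fst x + Suc r" using lt * by simp
      then have "F x = affine (n - fst x + Suc r) (fst x) (g x)"
        by (simp only: F_def)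
      also have "\<dots> = affine (Suc r) n (affine (n - fst x) (fst x) (g x))"
        using lt * by (subst affine_add) simp
      finally show ?thesis
        unfolding *(1) F_Suc[OF *(3)] *(3) by (simp only: sum_edge_inner_affine_bump)
    qed
    fix x y assume xy: "x \<in> I" "y \<in> I" "x \<noteq> y"
    consider "fst x < fst y" | "fst y < fst x" | "fst x = fst y" by linarith
    then show "(\<Sum>e\<in>E N. edge_inner (F x) (F y) e) = 0"
    proof cases
      case 1
      then show ?thesis using less xy by blast
    next
      case 2
      then have "(\<Sum>e\<in>E N. edge_inner (F y) (F x) e) = 0" using less xy by blast
      then show ?thesis by (simp add: edge_inner_def mult.commute)
    next
      case 3
      \<comment> \<open>Level 0 has only the constant, so distinct indices of equal level are bumps
        with different sign vectors.\<close>
      then obtain n r i where *: "x = (Suc n, i)" "i < M n" "N = Suc n + r"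
        using I_cases[OF xy(1)] I_cases[OF xy(2)] xy(3) by auto
      obtain j where j: "y = (Suc n, j)" "j < M n"
        using 3 * I_cases[OF xy(2)] by auto
      have ij: "i \<noteq> j" using xy(3) * j by simp
      show ?thesis
        unfolding *(1) j(1) F_Suc[OF *(3)] unfolding *(3)
        by (rule sum_edge_inner_bump[OF v_orth[OF *(2) j(2) ij]])
    qed
  next
    fix n assume n: "n \<le> N"
    show "real (k * m) ^ n / real (k * m) \<le> 2 * real (card {x \<in> I. fst x = n})"
    proof (cases n)
      case 0
      have "{x \<in> I. fst x = n} = {(0, 0)}" using 0 by (auto simp: I_def)
      moreover have "1 / real (k * m) \<le> 1"
        using km_gt_1 by (subst divide_le_eq_1_pos) linarith+
      ultimately show ?thesis using 0 by (simp del: of_nat_mult)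
    next
      case (Suc l)
      have "{x \<in> I. fst x = n} = Pair n ` {..<M l}" using Suc n by (auto simp: I_def)
      then have "card {x \<in> I. fst x = n} = M l"
        by (simp add: card_image inj_on_def)
      moreover have "real (k * m) ^ l \<le> 2 * real (M l)"
        using M[of l] by (metis less_imp_le of_nat_le_iff of_nat_mult of_nat_numeral of_nat_power)
      ultimately show ?thesis using Suc k2 m2 by (simp del: of_nat_mult)
    qed
  qed
qed

end

section \<open>Path metric and degree measure\<close>

text \<open>Double counting: the degree of \<open>x\<close> is a sum of incidences over the edges,
  and the two sums are exchanged.\<close>

lemma sum_degree_prob:
  assumes "finite (parcs G)" "finite A"
  shows "(\<Sum>x\<in>A. g x * degree_prob G x)
    = (\<Sum>e\<in>parcs G. of_bool (fst e \<in> A) * g (fst e) + of_bool (snd e \<in> A) * g (snd e))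
        / (2 * real (card (parcs G)))"
proof -
  have count: "real (card {e \<in> parcs G. q e = x}) = (\<Sum>e\<in>parcs G. of_bool (q e = x))"
    for q :: "'a \<times> 'a \<Rightarrow> 'a" and x
    using assms(1) by (simp add: of_bool_def sum.If_cases Int_def)
  have swap: "(\<Sum>x\<in>A. g x * (\<Sum>e\<in>parcs G. of_bool (q e = x)))
      = (\<Sum>e\<in>parcs G. of_bool (q e \<in> A) * g (q e))" for q :: "'a \<times> 'a \<Rightarrow> 'a"
  proof -
    have "(\<Sum>x\<in>A. g x * (\<Sum>e\<in>parcs G. of_bool (q e = x)))
        = (\<Sum>e\<in>parcs G. \<Sum>x\<in>A. if q e = x then g x else 0)"
      unfolding sum_distrib_left
      by (subst sum.swap) (auto intro!: sum.cong simp: of_bool_def)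
    also have "\<dots> = (\<Sum>e\<in>parcs G. of_bool (q e \<in> A) * g (q e))"
      using assms(2) by (intro sum.cong) (auto simp: sum.delta')
    finally show ?thesis .
  qed
  have "degree_prob G x = ((\<Sum>e\<in>parcs G. of_bool (snd e = x)) + (\<Sum>e\<in>parcs G. of_bool (fst e = x)))
      / (2 * real (card (parcs G)))" for x
    by (simp add: degree_prob_def in_degree_def out_degree_def in_arcs_def out_arcs_def count)
  then have "(\<Sum>x\<in>A. g x * degree_prob G x) =
      ((\<Sum>x\<in>A. g x * (\<Sum>e\<in>parcs G. of_bool (snd e = x)))
        + (\<Sum>x\<in>A. g x * (\<Sum>e\<in>parcs G. of_bool (fst e = x)))) / (2 * real (card (parcs G)))"
    by (simp add: sum_divide_distrib[symmetric] distrib_left sum.distrib)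
  then show ?thesis
    unfolding swap by (simp add: sum.distrib add.commute)
qed

text \<open>The arc itself is a walk of cost \<open>l\<close>; as its ends differ, every walk
  between them has at least one arc.\<close>

lemma path_metric_arc:
  assumes "pair_wf_digraph G" "e \<in> parcs G" "fst e \<noteq> snd e" "0 \<le> l"
  shows "path_metric G l (fst e) (snd e) = l"
proof -
  interpret G: pair_wf_digraph G by fact
  let ?S = "mk_symmetric (with_proj G)"
  interpret S: pair_wf_digraph ?S by (rule G.wellformed_mk_symmetric)
  have arc: "(fst e, snd e) \<in> parcs ?S"
    using assms(2) by (auto simp: parcs_mk_symmetric)
  have "S.\<mu> (\<lambda>_. l) (fst e) (snd e) = ereal l"
  proof (rule antisym)
    have "S.awalk (fst e) [(fst e, snd e)] (snd e)"
      using S.arc_implies_awalk[of "(fst e, snd e)"] arc by simp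
    then show "S.\<mu> (\<lambda>_. l) (fst e) (snd e) \<le> ereal l"
      using S.min_cost_le_walk_cost[of "fst e" "[(fst e, snd e)]" "snd e" "\<lambda>_. l"] by simp
  next
    show "ereal l \<le> S.\<mu> (\<lambda>_. l) (fst e) (snd e)"
      unfolding S.\<mu>_def
    proof (rule INF_greatest)
      fix w assume "w \<in> {w. S.awalk (fst e) w (snd e)}"
      then have "w \<noteq> []" using assms(3) by (auto simp: S.awalk_Nil_iff)
      then have "1 \<le> real (length w)" by (cases w) auto
      then have "1 * l \<le> real (length w) * l" using assms(4) by (intro mult_right_mono)
      then show "ereal l \<le> ereal (S.awalk_cost (\<lambda>_. l) w)"
        by (simp add: S.awalk_cost_def sum_list_triv)
    qed
  qed
  then show ?thesis by (simp add: path_metric_def)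
qed

text \<open>Between points not joined by a path, \<^const>\<open>path_metric\<close> takes the junk value 0, and so does the
  quotient in \<^const>\<open>Lip\<close>.\<close>

lemma Lip_le:
  assumes "pair_wf_digraph G" "0 < c" "x0 \<in> pverts G" "y0 \<in> pverts G" "x0 \<noteq> y0"
    and arcs: "\<And>e. e \<in> parcs G \<Longrightarrow> \<bar>f (fst e) - f (snd e)\<bar> \<le> c * l"
  shows "Lip (pverts G) (path_metric G l) f \<le> c"
  unfolding Lip_def
proof (rule cSUP_least)
  show "{(x, y). x \<in> pverts G \<and> y \<in> pverts G \<and> x \<noteq> y} \<noteq> {}" using assms by auto
next
  interpret G: pair_wf_digraph G by fact
  let ?S = "mk_symmetric (with_proj G)"
  interpret S: pair_wf_digraph ?S by (rule G.wellformed_mk_symmetric)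
  fix q assume "q \<in> {(x, y). x \<in> pverts G \<and> y \<in> pverts G \<and> x \<noteq> y}"
  obtain x y where q: "q = (x, y)" by force
  \<comment> \<open>Telescoping along the walk, whose arcs may be traversed in either
    direction.\<close>
  have walk: "\<bar>f u - f y\<bar> \<le> c * S.awalk_cost (\<lambda>_. l) w" if "S.awalk u w y" for u w
    using that
  proof (induction w arbitrary: u)
    case Nil
    then show ?case by (simp add: S.awalk_Nil_iff)
  next
    case (Cons e w)
    have e: "e \<in> parcs ?S" "fst e = u" "S.awalk (snd e) w y"
      using Cons.prems by (auto simp: S.awalk_Cons_iff)
    have "\<bar>f u - f (snd e)\<bar> \<le> c * l"
      using e(1,2) arcs by (auto simp: parcs_mk_symmetric abs_minus_commute)
    then show ?case using Cons.IH[OF e(3)] by (simp add: algebra_simps)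
  qed
  have le: "ereal (\<bar>f x - f y\<bar> / c) \<le> S.\<mu> (\<lambda>_. l) x y"
    unfolding S.\<mu>_def
    by (rule INF_greatest) (use walk assms(2) in \<open>auto simp: field_simps\<close>)
  show "\<bar>f (fst q) - f (snd q)\<bar> / path_metric G l (fst q) (snd q) \<le> c"
  proof (cases "S.\<mu> (\<lambda>_. l) x y")
    case (real d)
    then have *: "\<bar>f x - f y\<bar> / c \<le> d" "path_metric G l x y = d"
      using le by (auto simp: path_metric_def)
    moreover have "0 \<le> \<bar>f x - f y\<bar> / c" using assms(2) by simp
    ultimately have "0 \<le> d" by linarith
    then show ?thesis
      using * assms(2) by (cases "d = 0") (auto simp: q field_simps)
  qed (use assms(2) le in \<open>auto simp: q path_metric_def\<close>)
qed

context diamond_refinement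
begin

section \<open>Transfer to a graph with edge set \<open>E N\<close>\<close>

context
  fixes G :: "'v pair_pre_digraph" and N :: nat
  assumes wf: "pair_wf_digraph G" and fin: "finite (pverts G)" and parcs_G: "parcs G = E N"
begin

lemma card_parcs: "real (card (parcs G)) = real (k * m) ^ N"
  by (simp add: parcs_G card_E)

lemma sum_degree_prob_G:
  assumes "A \<subseteq> pverts G"
  shows "(\<Sum>x\<in>A. g x * degree_prob G x)
    = (\<Sum>e\<in>E N. of_bool (fst e \<in> A) * g (fst e) + of_bool (snd e \<in> A) * g (snd e)) / (2 * real (k * m) ^ N)"
  using sum_degree_prob[of G A g] finite_subset[OF assms fin] unfolding card_parcs by (simp add: parcs_G)

lemma ends_subset: "ends N \<subseteq> pverts G"
  using pair_wf_digraph.arc_fst_in_verts[OF wf] pair_wf_digraph.arc_snd_in_verts[OF wf]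
  by (auto simp: ends_def parcs_G)

lemma sum_degree_prob_pverts:
  "(\<Sum>x\<in>pverts G. g x * degree_prob G x) = (\<Sum>e\<in>E N. g (fst e) + g (snd e)) / (2 * real (k * m) ^ N)"
  using ends_subset unfolding sum_degree_prob_G[OF order.refl]
  by (intro arg_cong2[of _ _ _ _ "(/)"] sum.cong) (auto simp: ends_def subset_iff)

lemma isoperimetric_dimension_G:
  "isoperimetric_dimension G (degree_prob G) (uniform_prob G) (path_metric G (1 / real k ^ N))
    (1 + ln (real m) / ln (real k)) (real m / 2)"
  unfolding isoperimetric_dimension_def
proof (intro allI impI)
  fix A assume A: "A \<subseteq> pverts G"
  let ?\<mu> = "degree_prob G" and ?K = "real (k * m) ^ N"
  let ?P = "\<lambda>v. v \<in> A"
  have \<mu>A: "sum ?\<mu> A = (\<Sum>e\<in>E N. mass ?P e) / ?K"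
    using sum_degree_prob_G[OF A, of "\<lambda>_. 1"]
    by (simp add: mass_def sum_divide_distrib[symmetric] del: of_nat_mult)
  have "sum ?\<mu> (pverts G) = (\<Sum>e\<in>E N. 2) / (2 * ?K)"
    using sum_degree_prob_pverts[of "\<lambda>_. 1"] by simp
  then have "sum ?\<mu> (pverts G) = 1"
    using k2 m2 by (simp add: card_E)
  moreover have "sum ?\<mu> (pverts G) = sum ?\<mu> A + sum ?\<mu> (pverts G - A)"
    using A fin by (simp add: sum.subset_diff)
  ultimately have \<mu>B: "sum ?\<mu> (pverts G - A) = 1 - (\<Sum>e\<in>E N. mass ?P e) / ?K"
    using \<mu>A by simp
  have k: "0 < ln (real k)" and km: "0 < ln (real k) + ln (real m)" using k2 m2 by (auto intro: add_pos_pos)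
  have \<alpha>: "((1 + ln (real m) / ln (real k)) - 1) / (1 + ln (real m) / ln (real k)) = \<alpha>"
    using k km k2 m2 by (simp add: \<alpha>_def ln_mult field_simps)
  have cut: "edge_boundary G A = {e \<in> E N. (fst e \<in> A) \<noteq> (snd e \<in> A)}"
  proof -
    \<comment> \<open>By \<open>E_neq\<close> no edge is a loop, so meeting \<open>A\<close> in one
      point means having exactly one end in \<open>A\<close>.\<close>
    have "card ({x, y} \<inter> A) = 1 \<longleftrightarrow> (x \<in> A) \<noteq> (y \<in> A)" if "x \<noteq> y" for x y
      using that by (auto simp: Int_insert_left)
    then show ?thesis using E_neq by (auto simp: edge_boundary_def parcs_G)
  qed
  \<comment> \<open>Each cut edge has weight \<open>k ^ N / (k * m) ^ N = 1 / m ^ N\<close>.\<close>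
  have "perimeter G (uniform_prob G) (path_metric G (1 / real k ^ N)) A
      = (\<Sum>e\<in>edge_boundary G A. 1 / real m ^ N)"
    unfolding perimeter_def
  proof (rule sum.cong[OF refl])
    fix e assume "e \<in> edge_boundary G A"
    then have e: "e \<in> parcs G" "fst e \<noteq> snd e" by (auto simp: cut parcs_G)
    then show "uniform_prob G e / path_metric G (1 / real k ^ N) (fst e) (snd e) = 1 / real m ^ N"
      using k2 unfolding uniform_prob_def card_parcs
      by (subst path_metric_arc[OF wf e]) (auto simp: power_mult_distrib)
  qed
  also have "\<dots> = (\<Sum>e\<in>E N. local.cut ?P e) / real m ^ N"
    by (simp add: cut local.cut_def of_bool_def sum.If_cases Int_def)
  finally show "min (sum ?\<mu> A) (sum ?\<mu> (pverts G - A)) powr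
      ((1 + ln (real m) / ln (real k) - 1) / (1 + ln (real m) / ln (real k)))
      \<le> real m / 2 * perimeter G (uniform_prob G) (path_metric G (1 / real k ^ N)) A"
    using isoperimetric_E[of ?P N] unfolding \<alpha> \<mu>A \<mu>B by simp
qed

lemma lipschitz_spectral_profile_G:
  "lipschitz_spectral_profile G (degree_prob G) (path_metric G (1 / real k ^ N))
    (1 + ln (real m) / ln (real k)) (real k ^ N) 6 1 (2 * real k ^ 2 * real m ^ 2)"
proof -
  let ?\<mu> = "degree_prob G" and ?d = "path_metric G (1 / real k ^ N)" and ?V = "pverts G"
  let ?K = "real (k * m) ^ N" and ?\<delta> = "1 + ln (real m) / ln (real k)"
  have K: "0 < ?K" using km_gt_1 by simp
  obtain I F where finI: "finite (I :: (nat \<times> nat) set)"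
    and bounded: "\<And>x v. x \<in> I \<Longrightarrow> v \<in> ends N \<Longrightarrow> \<bar>F x v\<bar> \<le> 1"
    and large: "\<And>x. x \<in> I \<Longrightarrow> ?K / 3 \<le> (\<Sum>e\<in>E N. \<bar>F x (fst e)\<bar> + \<bar>F x (snd e)\<bar>)"
    and orth: "\<And>x y. x \<in> I \<Longrightarrow> y \<in> I \<Longrightarrow> x \<noteq> y \<Longrightarrow> (\<Sum>e\<in>E N. edge_inner (F x) (F y) e) = 0"
    and diff: "\<And>x e. x \<in> I \<Longrightarrow> e \<in> E N \<Longrightarrow> \<bar>F x (fst e) - F x (snd e)\<bar> \<le> real k ^ fst x / real k ^ N"
    and count: "\<And>n. n \<le> N \<Longrightarrow> real (k * m) ^ n / real (k * m) \<le> 2 * real (card {x \<in> I. fst x = n})"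
    using spectral_E[of N] by blast
  have "E N \<noteq> {}" using card_E[of N] k2 m2 by auto
  then obtain e0 where e0: "e0 \<in> E N" by auto
  have e0V: "fst e0 \<in> ?V" "snd e0 \<in> ?V" "fst e0 \<noteq> snd e0"
    using e0 ends_subset E_neq by auto
  have Lip: "Lip ?V ?d (F x) \<le> real k ^ fst x" if "x \<in> I" for x
    by (rule Lip_le[OF wf _ e0V]) (use k2 diff[OF that] in \<open>auto simp: parcs_G\<close>)
  have L1: "inverse 6 \<le> L1_norm ?V ?\<mu> (F x)" if "x \<in> I" for x
  proof -
    \<comment> \<open>The third from \<open>large\<close> is halved, since the denominator of the
      degree measure counts both ends of every edge.\<close>
    have "?K / 3 / (2 * ?K) \<le> L1_norm ?V ?\<mu> (F x)"
      unfolding L1_norm_def sum_degree_prob_pverts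
      using K by (intro divide_right_mono large[OF that]) auto
    then show ?thesis using k2 m2 by simp
  qed
  \<comment> \<open>Points of positive mass are ends of edges, where \<open>bounded\<close>
    applies.\<close>
  have pos: "x \<in> ends N" if "0 < ?\<mu> x" for x
  proof (rule ccontr)
    assume "x \<notin> ends N"
    then have "in_arcs (with_proj G) x = {}" "out_arcs (with_proj G) x = {}"
      by (force simp: in_arcs_def out_arcs_def parcs_G ends_def)+
    then show False using that by (simp add: degree_prob_def in_degree_def out_degree_def)
  qed
  \<comment> \<open>A point of positive mass makes the set under the \<open>Max\<close> in
    \<open>Linf_norm\<close> nonempty.\<close>
  have "0 < ?\<mu> (fst e0)"
  proof -
    have "e0 \<in> out_arcs (with_proj G) (fst e0)" using e0 by (simp add: parcs_G)
    moreover have "finite (out_arcs (with_proj G) (fst e0))"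
      by (rule finite_subset[of _ "E N"]) (auto simp: out_arcs_def parcs_G)
    ultimately have "0 < out_degree (with_proj G) (fst e0)"
      unfolding out_degree_def by (auto simp: card_gt_0_iff)
    then show ?thesis using k2 m2 unfolding degree_prob_def card_parcs by simp
  qed
  then have Linf: "Linf_norm ?V ?\<mu> (F x) \<le> 1" if "x \<in> I" for x
    unfolding Linf_norm_def using fin e0V bounded[OF that] pos
    by (subst Max_le_iff) auto
  have L2: "L2_inner ?V ?\<mu> (F x) (F y) = 0" if "x \<in> I" "y \<in> I" "x \<noteq> y" for x y
    using orth[OF that] unfolding L2_inner_def sum_degree_prob_pverts by (simp add: edge_inner_def)
  have \<delta>: "(real k ^ n) powr ?\<delta> = real (k * m) ^ n" for n
  proof -
    have "real k powr (ln (real m) / ln (real k)) = real m"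
      using k2 m2 by (simp add: powr_def)
    then have k\<delta>: "real k powr ?\<delta> = real (k * m)"
      using k2 by (simp add: powr_add)
    have "(real k ^ n) powr ?\<delta> = (real k powr ?\<delta>) ^ n"
      by (induction n) (use k2 in \<open>auto simp: powr_mult\<close>)
    then show ?thesis by (simp only: k\<delta>)
  qed
  have \<delta>_ge: "1 \<le> ?\<delta>" using k2 m2 by simp
  have prof: "inverse (2 * real k ^ 2 * real m ^ 2) * s powr ?\<delta>
      \<le> real (profile_count ?V ?d (prod_encode ` I) (\<lambda>t. F (prod_decode t)) s)"
    if s: "s \<in> {1..real k ^ N}" for s
  proof -
    \<comment> \<open>Rounding \<open>s\<close> up to \<open>k ^ Suc n\<close> costs one factor
      \<open>k * m\<close>; \<open>count\<close> costs another one and the factor 2.\<close>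
    obtain n where n: "n \<le> N" "real k ^ n \<le> s" "s \<le> real k ^ Suc n"
      using ex_power_bounds[of "real k" s N] s k2 by auto
    have "s powr ?\<delta> \<le> (real k ^ Suc n) powr ?\<delta>"
      using s n \<delta>_ge by (intro powr_mono2) auto
    also have "\<dots> = real (k * m) ^ Suc n" by (rule \<delta>)
    also have "\<dots> = real (k * m) ^ 2 * (real (k * m) ^ n / real (k * m))"
      using k2 m2 by (simp add: power2_eq_square)
    also have "\<dots> \<le> real (k * m) ^ 2 * (2 * real (card {x \<in> I. fst x = n}))"
      by (intro mult_left_mono count n) auto
    finally have "s powr ?\<delta> \<le> (2 * real k ^ 2 * real m ^ 2) * real (card {x \<in> I. fst x = n})"
      by (simp add: power_mult_distrib mult_ac)
    then have "inverse (2 * real k ^ 2 * real m ^ 2) * s powr ?\<delta> \<le> real (card {x \<in> I. fst x = n})"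
      using k2 m2 by (simp add: field_simps)
    \<comment> \<open>\<open>prod_encode\<close> turns the pairs into the natural numbers required
      as indices.\<close>
    also have "card {x \<in> I. fst x = n} = card (prod_encode ` {x \<in> I. fst x = n})"
      by (simp add: card_image inj_prod_encode)
    also have "\<dots> \<le> profile_count ?V ?d (prod_encode ` I) (\<lambda>t. F (prod_decode t)) s"
      unfolding profile_count_def
    proof (rule card_mono)
      show "finite {i \<in> prod_encode ` I. Lip ?V ?d (F (prod_decode i)) \<le> s}" using finI by simp
      show "prod_encode ` {x \<in> I. fst x = n} \<subseteq> {i \<in> prod_encode ` I. Lip ?V ?d (F (prod_decode i)) \<le> s}"
        using Lip n(2) by force
    qed
    finally show ?thesis by simp
  qed
  show ?thesis
    unfolding lipschitz_spectral_profile_def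
  proof (intro conjI exI[of _ "prod_encode ` I"] exI[of _ "\<lambda>t. F (prod_decode t)"] ballI impI)
    show "1 \<le> real k ^ N" using k2 by simp
  qed (use \<delta>_ge k2 m2 L1 Linf L2 prof in auto)
qed

end
end

section \<open>Powers of diamond graphs\<close>

text \<open>Positions are integers and branches are counted from 0, as in the refinement scheme;
  hence the shift \<open>Suc b\<close>.\<close>

definition diamond_vertex :: "nat \<Rightarrow> nat \<Rightarrow> nat \<Rightarrow> nat \<Rightarrow> (real \<times> nat) set" where
  "diamond_vertex k m i b = diamond_class k m (real i / real k) (Suc b)"

lemma diamond_vertex_eq:
  assumes "0 < k" "i \<le> k" "b < m"
  shows "diamond_vertex k m i b
    = (if i = 0 \<or> i = k then {real i / real k} \<times> {1..m} else {(real i / real k, Suc b)})"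
proof -
  have "real i / real k \<in> pverts (path_graph k)" using assms(2) by (auto simp: path_graph_def)
  moreover have "real i / real k = 0 \<longleftrightarrow> i = 0" "real i / real k = 1 \<longleftrightarrow> i = k"
    using assms(1) by auto
  ultimately show ?thesis
    using assms(3) unfolding diamond_vertex_def diamond_class_def diamond_rel_def by auto
qed

lemma diamond_vertex_eq_iff:
  assumes "0 < k" "i \<le> k" "b < m" "i' \<le> k" "b' < m"
  shows "diamond_vertex k m i b = diamond_vertex k m i' b'
    \<longleftrightarrow> i = i' \<and> (b = b' \<or> i = 0 \<or> i = k)"
proof -
  have mem: "(real i / real k, Suc b) \<in> diamond_vertex k m i b" if "i \<le> k" "b < m" for i b
    using assms(1) that by (auto simp: diamond_vertex_eq)
  have fst_eq: "x = real i / real k" if "(x, j) \<in> diamond_vertex k m i b" "i \<le> k" "b < m" for x j i b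
    using that(1) unfolding diamond_vertex_eq[OF assms(1) that(2,3)] by (auto split: if_splits)
  show ?thesis
  proof (cases "i = i'")
    case True
    then show ?thesis
      unfolding diamond_vertex_eq[OF assms(1-3)] diamond_vertex_eq[OF assms(1,4,5)] by auto
  next
    case False
    then have "real i / real k \<noteq> real i' / real k" using assms(1) by simp
    then have "diamond_vertex k m i b \<noteq> diamond_vertex k m i' b'"
      using mem[OF assms(2,3)] fst_eq[OF _ assms(4,5)] by metis
    then show ?thesis using False by simp
  qed
qed

lemma diamond_verts:
  assumes "0 < k"
  shows "st_verts (diamond k m) = {diamond_vertex k m i b | i b. i \<le> k \<and> b < m}"
proof -
  have "pverts (path_graph k) = (\<lambda>i. real i / real k) ` {..k}"
    by (auto simp: path_graph_def)
  then have "st_verts (diamond k m)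
      = (\<lambda>(x, j). diamond_class k m x j) ` ((\<lambda>i. real i / real k) ` {..k} \<times> Suc ` {..<m})"
    by (force simp: diamond_def quotient_def diamond_class_def image_Suc_lessThan)
  then show ?thesis
    by (force simp: diamond_vertex_def)
qed

lemma diamond_arcs:
  "st_arcs (diamond k m)
    = (\<lambda>(i, b). (diamond_vertex k m i b, diamond_vertex k m (Suc i) b)) ` ({..<k} \<times> {..<m})"
proof (intro equalityI subsetI)
  fix f assume "f \<in> st_arcs (diamond k m)"
  then obtain i j where ij: "1 \<le> i" "i \<le> k" "j \<in> {1..m}"
    "f = (diamond_class k m (real (i - 1) / real k) j, diamond_class k m (real i / real k) j)"
    by (auto simp: diamond_def path_graph_def)
  then have "f = (diamond_vertex k m (i - 1) (j - 1), diamond_vertex k m (Suc (i - 1)) (j - 1))"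
    by (simp add: diamond_vertex_def)
  moreover have "(i - 1, j - 1) \<in> {..<k} \<times> {..<m}" using ij by auto
  ultimately show "f \<in> (\<lambda>(i, b). (diamond_vertex k m i b, diamond_vertex k m (Suc i) b)) ` ({..<k} \<times> {..<m})"
    by (intro image_eqI[of _ _ "(i - 1, j - 1)"]) simp_all
next
  fix f assume "f \<in> (\<lambda>(i, b). (diamond_vertex k m i b, diamond_vertex k m (Suc i) b)) ` ({..<k} \<times> {..<m})"
  then obtain i b where ib: "i < k" "b < m" "f = (diamond_vertex k m i b, diamond_vertex k m (Suc i) b)"
    by auto
  have "(real i / real k, real (Suc i) / real k) \<in> parcs (path_graph k)"
    using ib by (auto simp: path_graph_def intro!: exI[of _ "Suc i"])
  moreover have "Suc b \<in> {1..m}" using ib by simp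
  moreover have "f = (diamond_class k m (fst (real i / real k, real (Suc i) / real k)) (Suc b),
      diamond_class k m (snd (real i / real k, real (Suc i) / real k)) (Suc b))"
    using ib by (simp add: diamond_vertex_def)
  ultimately show "f \<in> st_arcs (diamond k m)"
    unfolding diamond_def by auto
qed

lemma source_diamond: "source (diamond k m) = diamond_vertex k m 0 0"
  by (simp add: diamond_def diamond_vertex_def)

lemma sink_diamond: "0 < k \<Longrightarrow> sink (diamond k m) = diamond_vertex k m k 0"
  by (simp add: diamond_def diamond_vertex_def)

section \<open>Classes of the slash product\<close>

lemma slash_class_inner:
  assumes "e \<in> st_arcs H" "u \<in> st_verts G" "u \<noteq> source G" "u \<noteq> sink G"
  shows "slash_class H G e u = {(e, u)}"
  using assms by (auto simp: slash_class_def slash_rel_def)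

lemma slash_class_source:
  assumes "e \<in> st_arcs H" "source G \<in> st_verts G" "sink G \<in> st_verts G"
  shows "slash_class H G e (source G) = slash_embed H G (fst e)"
  using assms by (auto simp: slash_class_def slash_rel_def slash_embed_def slash_endpoint_def)

lemma slash_class_sink:
  assumes "e \<in> st_arcs H" "source G \<in> st_verts G" "sink G \<in> st_verts G" "source G \<noteq> sink G"
  shows "slash_class H G e (sink G) = slash_embed H G (snd e)"
  using assms by (auto simp: slash_class_def slash_rel_def slash_embed_def slash_endpoint_def)

lemma slash_embed_nonempty:
  assumes "v \<in> fst ` st_arcs H \<union> snd ` st_arcs H" "source G \<noteq> sink G"
  shows "slash_embed H G v \<noteq> {}"
proof -
  consider e where "e \<in> st_arcs H" "v = fst e" | e where "e \<in> st_arcs H" "v = snd e"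
    using assms(1) by auto
  then show ?thesis
  proof cases
    case 1
    then have "(e, source G) \<in> slash_embed H G v" by (simp add: slash_embed_def slash_endpoint_def)
    then show ?thesis by auto
  next
    case 2
    then have "(e, sink G) \<in> slash_embed H G v"
      using assms(2) by (simp add: slash_embed_def slash_endpoint_def)
    then show ?thesis by auto
  qed
qed

text \<open>A nonempty class determines its vertex through \<open>slash_endpoint\<close>. The domain
  consists of ends of edges because the class of an isolated vertex is empty.\<close>

lemma inj_slash_embed:
  assumes "source G \<noteq> sink G"
  shows "inj_on (slash_embed H G) (fst ` st_arcs H \<union> snd ` st_arcs H)"
proof (rule inj_onI)
  fix v w assume v: "v \<in> fst ` st_arcs H \<union> snd ` st_arcs H" and eq: "slash_embed H G v = slash_embed H G w"
  obtain q where "q \<in> slash_embed H G v"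
    using slash_embed_nonempty[OF v assms] by auto
  then show "v = w" using eq by (auto simp: slash_embed_def)
qed

lemma finite_slash_embed: "finite (st_arcs H) \<Longrightarrow> finite (slash_embed H G v)"
  by (rule finite_subset[of _ "st_arcs H \<times> {source G, sink G}"]) (auto simp: slash_embed_def)

lemma slash_arcs:
  "st_arcs (slash H G) = (\<lambda>(e, f). (slash_class H G e (fst f), slash_class H G e (snd f))) ` (st_arcs H \<times> st_arcs G)"
  by (force simp: slash_def)

lemma slash_verts:
  "st_verts (slash H G) = (\<lambda>(e, u). slash_class H G e u) ` (st_arcs H \<times> st_verts G)"
  by (force simp: slash_def quotient_def slash_class_def)

lemma diamond_wf:
  assumes "0 < k"
  shows "pair_wf_digraph (digraph_of (diamond k m))"
    and "finite (st_verts (diamond k m))" "finite (st_arcs (diamond k m))"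
proof -
  show "pair_wf_digraph (digraph_of (diamond k m))"
    by unfold_locales (fastforce simp: diamond_verts[OF assms] diamond_arcs)+
  have "st_verts (diamond k m) = (\<lambda>(i, b). diamond_vertex k m i b) ` ({..k} \<times> {..<m})"
    by (force simp: diamond_verts[OF assms])
  then show "finite (st_verts (diamond k m))" by simp
  show "finite (st_arcs (diamond k m))" by (simp add: diamond_arcs)
qed

text \<open>Finiteness is carried along with well-formedness because \<open>Abs_fset\<close> is
  known to be injective only on finite sets.\<close>

lemma slash_power_wf:
  assumes "pair_wf_digraph (digraph_of G)" "finite (st_verts G)" "finite (st_arcs G)"
  shows "pair_wf_digraph (digraph_of (slash_power G (Suc n)))"
    and "finite (st_verts (slash_power G (Suc n)))" "finite (st_arcs (slash_power G (Suc n)))"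
proof (induction n)
  case 0
  interpret pair_wf_digraph "digraph_of G" by fact
  { case 1
    show ?case
      using arc_fst_in_verts arc_snd_in_verts by unfold_locales (force simp: relabel_def)+
  next case 2 show ?case using assms by (simp add: relabel_def)
  next case 3 show ?case using assms by (simp add: relabel_def) }
next
  case (Suc n)
  interpret pair_wf_digraph "digraph_of G" by fact
  { case 1
    show ?case
      using arc_fst_in_verts arc_snd_in_verts
      by unfold_locales (force simp: relabel_def slash_arcs slash_verts)+
  next case 2 show ?case using assms Suc by (simp add: relabel_def slash_verts)
  next case 3 show ?case using assms Suc by (simp add: relabel_def slash_arcs) }
qed

section \<open>Powers as iterated refinement\<close>

text \<open>Level 0 is a single edge, so that the first power is also obtained by replacing edges by
  diamonds.\<close>

definition power_arcs :: "nat \<Rightarrow> nat \<Rightarrow> nat \<Rightarrow>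
    ((real \<times> nat) set power_vertex \<times> (real \<times> nat) set power_vertex) set" where
  "power_arcs k m n =
    (if n = 0 then {(Base (source (diamond k m)), Base (sink (diamond k m)))}
     else st_arcs (slash_power (diamond k m) n))"

text \<open>The vertices of level 0 already bear the labels that they have in the first power, so
  this embedding starts with the identity.\<close>

definition power_embed ::
    "nat \<Rightarrow> nat \<Rightarrow> nat \<Rightarrow> (real \<times> nat) set power_vertex \<Rightarrow> (real \<times> nat) set power_vertex" where
  "power_embed k m n v =
    (if n = 0 then v
     else Class (Abs_fset (slash_embed (slash_power (diamond k m) n) (diamond k m) v)))"

definition power_point ::
    "nat \<Rightarrow> nat \<Rightarrow> nat \<Rightarrow> (real \<times> nat) set power_vertex \<times> (real \<times> nat) set power_vertex
      \<Rightarrow> nat \<Rightarrow> nat \<Rightarrow> (real \<times> nat) set power_vertex" where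
  "power_point k m n e i b =
    (if n = 0 then Base (diamond_vertex k m i b)
     else Class (Abs_fset (slash_class (slash_power (diamond k m) n) (diamond k m) e
       (diamond_vertex k m i b))))"

text \<open>An interior vertex of a copy has a singleton class \<open>{(e, u)}\<close>, which
  determines \<open>e\<close> and \<open>u\<close>; the class of an old vertex consists of pairs
  with the source or the sink. This gives injectivity and disjointness.\<close>

lemma diamond_refinement_power:
  assumes k: "2 \<le> k" and m: "2 \<le> m"
  shows "diamond_refinement k m (power_arcs k m) (power_embed k m) (power_point k m)
    (Base (source (diamond k m))) (Base (sink (diamond k m)))"
proof -
  let ?D = "diamond k m" and ?v = "diamond_vertex k m"
  let ?P = "slash_power ?D"
  let ?h = "\<lambda>X. Class (Abs_fset X) :: (real \<times> nat) set power_vertex"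
  have k0: "0 < k" and m0: "0 < m" using k m by auto
  have v_D: "?v i b \<in> st_verts ?D" if "i \<le> k" "b < m" for i b
    using that by (auto simp: diamond_verts[OF k0])
  have src: "source ?D = ?v 0 b" and snk: "sink ?D = ?v k b" if "b < m" for b
    using that k0 m0 by (simp_all add: source_diamond sink_diamond diamond_vertex_eq_iff)
  have ne: "source ?D \<noteq> sink ?D"
    using k0 m0 by (simp add: source_diamond sink_diamond diamond_vertex_eq_iff)
  have sv: "source ?D \<in> st_verts ?D" "sink ?D \<in> st_verts ?D"
    using v_D[of 0 0] v_D[of k 0] m0 k0 by (simp_all add: source_diamond sink_diamond)
  have inner: "?v i b \<noteq> source ?D" "?v i b \<noteq> sink ?D" if "0 < i" "i < k" "b < m" for i b
    using that k0 m0 by (simp_all add: source_diamond sink_diamond diamond_vertex_eq_iff)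
  note wf = slash_power_wf[OF diamond_wf[OF k0, of m]]
  have finA: "finite (st_arcs (?P n))" if "0 < n" for n
    using wf(3)[of "n - 1"] that by simp
  have point_inner: "power_point k m n e i b = ?h {(e, ?v i b)}"
    if "0 < n" "e \<in> power_arcs k m n" "0 < i" "i < k" "b < m" for n e i b
    using that inner v_D by (simp add: power_point_def power_arcs_def slash_class_inner)
  have image_Times: "(\<lambda>(e, f). F e f) ` (A \<times> (\<lambda>(i, b). g i b) ` (B \<times> C))
      = (\<lambda>(e, i, b). F e (g i b)) ` (A \<times> B \<times> C)"
    for F :: "'x \<Rightarrow> 'y \<Rightarrow> 'z" and A and g :: "nat \<Rightarrow> nat \<Rightarrow> 'y" and B C
    by force
  \<comment> \<open>The relabelling is injective on the classes because they are finite.\<close>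
  have h_eq: "Abs_fset X = Abs_fset Y \<longleftrightarrow> X = Y" if "finite X" "finite Y" for X Y :: "'x set"
    using that by (simp add: Abs_fset_inject)
  have embed_eq: "power_embed k m n v = ?h (slash_embed (?P n) ?D v)"
      "finite (slash_embed (?P n) ?D v)" if "0 < n" for n v
    using that finA by (simp_all add: power_embed_def finite_slash_embed)
  show ?thesis
  proof
    show "2 \<le> k" "2 \<le> m" by fact+
    show "power_arcs k m 0 = {(Base (source ?D), Base (sink ?D))}" by (simp add: power_arcs_def)
    show "Base (source ?D) \<noteq> Base (sink ?D)" using ne by simp
  next
    fix n
    show "power_arcs k m (Suc n) = (\<lambda>(e, i, b). (power_point k m n e i b, power_point k m n e (Suc i) b))
        ` (power_arcs k m n \<times> {..<k} \<times> {..<m})"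
    proof (cases n)
      case 0
      let ?g = "\<lambda>(i, b). (?v i b, ?v (Suc i) b)" and ?e = "(Base (source ?D), Base (sink ?D))"
      have "power_arcs k m (Suc n) = map_prod Base Base ` ?g ` ({..<k} \<times> {..<m})"
        using 0 by (simp add: power_arcs_def relabel_def diamond_arcs)
      also have "\<dots> = (\<lambda>(e, f). map_prod Base Base f) ` ({?e} \<times> ?g ` ({..<k} \<times> {..<m}))"
        by force
      also have "\<dots> = (\<lambda>(e, i, b). map_prod Base Base (?v i b, ?v (Suc i) b)) ` ({?e} \<times> {..<k} \<times> {..<m})"
        by (rule image_Times)
      finally show ?thesis
        using 0 by (simp add: power_arcs_def power_point_def)
    next
      case (Suc l)
      show ?thesis
        unfolding Suc power_arcs_def power_point_def
        using image_Times[of "\<lambda>e f. (?h (slash_class (?P n) ?D e (fst f)), ?h (slash_class (?P n) ?D e (snd f)))"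
            "st_arcs (?P n)" "\<lambda>i b. (?v i b, ?v (Suc i) b)" "{..<k}" "{..<m}"]
        by (simp add: Suc relabel_def slash_arcs diamond_arcs image_image case_prod_unfold)
    qed
  next
    fix n e b assume e: "e \<in> power_arcs k m n" and b: "b < m"
    show "power_point k m n e 0 b = power_embed k m n (fst e)"
      using e slash_class_source[of e "?P n" ?D] sv
      by (auto simp: power_point_def power_embed_def power_arcs_def src[OF b] split: if_splits)
    show "power_point k m n e k b = power_embed k m n (snd e)"
      using e slash_class_sink[of e "?P n" ?D] sv ne
      by (auto simp: power_point_def power_embed_def power_arcs_def snk[OF b] split: if_splits)
  next
    fix n
    show "inj_on (power_embed k m n) (fst ` power_arcs k m n \<union> snd ` power_arcs k m n)"
    proof (cases "n = 0")
      case True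
      then show ?thesis by (simp add: inj_on_def power_embed_def)
    next
      case False
      then have "inj_on (slash_embed (?P n) ?D) (fst ` power_arcs k m n \<union> snd ` power_arcs k m n)"
        using inj_slash_embed[OF ne, of "?P n"] by (simp add: power_arcs_def)
      moreover have "power_embed k m n v = power_embed k m n w \<longleftrightarrow>
          slash_embed (?P n) ?D v = slash_embed (?P n) ?D w" for v w
        using False by (simp add: embed_eq h_eq)
      ultimately show ?thesis unfolding inj_on_def by blast
    qed
  next
    fix n
    show "inj_on (\<lambda>(e, i, b). power_point k m n e i b) (power_arcs k m n \<times> {0<..<k} \<times> {..<m})"
    proof (cases "n = 0")
      case True
      then have "e = e' \<and> i = i' \<and> b = b'"
        if "e \<in> power_arcs k m n" "e' \<in> power_arcs k m n" "0 < i" "i < k" "0 < i'" "i' < k" "b < m" "b' < m"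
          "power_point k m n e i b = power_point k m n e' i' b'" for e e' i i' b b'
        using that k0 by (simp add: power_point_def power_arcs_def diamond_vertex_eq_iff)
      then show ?thesis by (intro inj_onI) fastforce
    next
      case False
      then have "e = e' \<and> i = i' \<and> b = b'"
        if "e \<in> power_arcs k m n" "e' \<in> power_arcs k m n" "0 < i" "i < k" "0 < i'" "i' < k" "b < m" "b' < m"
          "power_point k m n e i b = power_point k m n e' i' b'" for e e' i i' b b'
        using that k0 by (simp add: point_inner h_eq diamond_vertex_eq_iff)
      then show ?thesis by (intro inj_onI) fastforce
    qed
  next
    fix n e i b assume *: "e \<in> power_arcs k m n" "0 < i" "i < k" "b < m"
    show "power_point k m n e i b \<notin> power_embed k m n ` (fst ` power_arcs k m n \<union> snd ` power_arcs k m n)"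
    proof (cases "n = 0")
      case True
      then show ?thesis
        using * inner by (auto simp: power_point_def power_embed_def power_arcs_def)
    next
      case False
      have "{(e, ?v i b)} \<noteq> slash_embed (?P n) ?D v" for v
      proof -
        have "(e, ?v i b) \<notin> slash_embed (?P n) ?D v"
          using inner[OF *(2-4)] by (simp add: slash_embed_def)
        then show ?thesis by (metis singletonI)
      qed
      then have "power_point k m n e i b \<noteq> power_embed k m n v" for v
        using False * by (simp add: point_inner embed_eq h_eq)
      then show ?thesis by blast
    qed
  qed
qed

theorem theoremC:
  fixes k m n :: nat
  assumes "2 \<le> k" and "2 \<le> m" and "1 \<le> n"
  shows "let G = digraph_of (slash_power (diamond k m) n);
             d = path_metric G (1 / real k ^ n);
             \<mu> = degree_prob G;
             \<nu> = uniform_prob G;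
             \<delta> = 1 + ln (real m) / ln (real k)
         in (\<exists>C_iso. C_iso \<le> real m / 2 \<and> isoperimetric_dimension G \<mu> \<nu> d \<delta> C_iso) \<and>
            (\<exists>C_1 C_inf C_gam. C_1 \<le> 6 \<and> C_inf \<le> 1 \<and> C_gam \<le> 2 * real k ^ 2 * real m ^ 2 \<and>
               lipschitz_spectral_profile G \<mu> d \<delta> (real k ^ n) C_1 C_inf C_gam)"
proof -
  interpret diamond_refinement k m "power_arcs k m" "power_embed k m" "power_point k m"
    "Base (source (diamond k m))" "Base (sink (diamond k m))"
    by (rule diamond_refinement_power[OF assms(1,2)])
  let ?G = "digraph_of (slash_power (diamond k m) n)"
  obtain l where l: "n = Suc l" using assms(3) by (cases n) auto
  have k0: "0 < k" using assms(1) by simp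
  note wf = slash_power_wf[OF diamond_wf[OF k0, of m], of l, folded l]
  have arcs: "parcs ?G = power_arcs k m n" using l by (simp add: power_arcs_def)
  show ?thesis
    using isoperimetric_dimension_G[OF wf(1,2) arcs] lipschitz_spectral_profile_G[OF wf(1,2) arcs]
    unfolding Let_def by (intro conjI) blast+
qed

end
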